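(* Let $X\subseteq\mathbb{R}^m$ ($m>1$) and $Y\subseteq\mathbb{R}$ be bounded open sets with $0\in\overline X$, let $c\in C^2(\overline X\times\overline Y)$ be twisted and non-degenerate, let $\nu$ be a fixed probability measure on $Y$, absolutely continuous with density $\bar\nu$, and let $g:[0,\infty)\to\mathbb{R}$ be continuously differentiable on $(0,\infty)$ and strictly convex with superlinear growth at infinity and $\lim_{s\to0^+}g'(s)=-\infty$. Let $\mu$ be any minimizer over $P(\overline X)$ of $$\mu\mapsto\mathcal T_c(\mu,\nu)+\int_Xg(\bar\mu(x))\,dx,$$ and let $k(\cdot)$ be the associated mass-splitting level. Assume that for all $y_0<y<y_1$ (with $y_0,y_1\in Y$) and all $x\in X_\ge(y_1,k_{max}(y_0,y_1,k(y_0)))\setminus X_\ge(y_0,k(y_0))$ we have $$(g')^{-1}\big(K_{M_c|\cdot|}(1)+M_c|x|\big)<\frac{\bar\nu(y)(y_1-y_0)}{D^{min}_{vol}(y_0,y_1,k(y_0))},$$ where $M_c$ is a Lipschitz constant for $x\mapsto c(x,y)$, uniform in $y\in\overline Y$. Then the model $(c,\mu,\nu)$ is nested.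
   Context: $P(\overline X)$ is the set of Borel probability measures on $\overline X$. $\mathcal T_c(\mu,\nu)=\inf_{\gamma\in\Pi(\mu,\nu)}\int c\,d\gamma$, with $\Pi(\mu,\nu)$ the couplings of $\mu$ and $\nu$. The term $\int_Xg(\bar\mu)\,dx$ is $+\infty$ if $\mu$ is not absolutely continuous; otherwise $\bar\mu$ is the density of $\mu$. Twisted: for each $x\in X$ the map $y\mapsto D_xc(x,y)$ is injective on $Y$. Non-degenerate: $D^2_{xy}c(x,y)\ne0$ for all $(x,y)\in\overline X\times\overline Y$. For a bounded function $w:X\to\mathbb{R}$, $K_w:(0,\infty)\to\mathbb{R}$ is the inverse of the increasing function $z\mapsto\int_X(g')^{-1}(z-w(x))\,dx$ from $\mathbb{R}$ onto $(0,\infty)$; $K_{M_c|\cdot|}$ is $K_w$ with $w(x)=M_c|x|$. For $y\in Y$ and $k\in\mathbb{R}$: $X_=(y,k)=\{x\in X:\frac{\partial c}{\partial y}(x,y)=k\}$, $X_\ge(y,k)=\{x\in X:\frac{\partial c}{\partial y}(x,y)\ge k\}$, $X_>(y,k)=X_\ge(y,k)\setminus X_=(y,k)$. The mass-splitting level $k(y)$, $y\in Y$, is defined by $\mu(X_\ge(y,k(y)))=\nu((-\infty,y])$ (if this does not determine $k(y)$ uniquely, $k$ denotes a fixed choice). The model $(c,\mu,\nu)$ is nested if for all $y_0<y_1$ in $Y$: $\nu([y_0,y_1])>0$ implies $X_\ge(y_0,k(y_0))\subseteq X_>(y_1,k(y_1))$. For $y_0<y_1$ in $Y$: $k_{max}(y_0,y_1,k_0)=\sup\{k: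 X_\ge(y_0,k_0)\subseteq X_\ge(y_1,k)\}$ and $D^{min}_{vol}(y_0,y_1,k_0)$ is the Lebesgue measure of $X_\ge(y_1,k_{max}(y_0,y_1,k_0))\setminus X_\ge(y_0,k_0)$ (if $X_\ge(y_0,k_0)=\emptyset$ then $k_{max}=+\infty$ and this is $0$). When $D^{min}_{vol}=0$ the right-hand side of the assumed inequality is read as $+\infty$. *)

theory Defs
  imports "HOL-Probability.Probability"
begin

text \<open>For open \<open>S\<close>, \<open>D1\<close> and \<open>D2\<close> are the first and second derivatives of \<open>f\<close> on \<open>S\<close>, extended
  continuously to the closure of \<open>S\<close>. Their values on \<open>closure S\<close> are determined by \<open>f\<close>.\<close>

definition C2_derivatives ::
  "'a::real_normed_vector set \<Rightarrow> ('a \<Rightarrow> real) \<Rightarrow> ('a \<Rightarrow> 'a \<Rightarrow>\<^sub>L real) \<Rightarrow> ('a \<Rightarrow> 'a \<Rightarrow>\<^sub>L 'a \<Rightarrow>\<^sub>L real) \<Rightarrow> bool"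
where
  "C2_derivatives S f D1 D2 \<longleftrightarrow>
     continuous_on (closure S) f \<and> continuous_on (closure S) D1 \<and> continuous_on (closure S) D2 \<and>
     (\<forall>p\<in>S. (f has_derivative blinfun_apply (D1 p)) (at p)) \<and>
     (\<forall>p\<in>S. (D1 has_derivative blinfun_apply (D2 p)) (at p))"

definition C2_closure :: "'a::real_normed_vector set \<Rightarrow> ('a \<Rightarrow> real) \<Rightarrow> bool" where
  "C2_closure S f \<longleftrightarrow> (\<exists>D1 D2. C2_derivatives S f D1 D2)"

definition second_derivative ::
  "'a::real_normed_vector set \<Rightarrow> ('a \<Rightarrow> real) \<Rightarrow> 'a \<Rightarrow> 'a \<Rightarrow>\<^sub>L 'a \<Rightarrow>\<^sub>L real" where
  "second_derivative S f = (SOME D2. \<exists>D1. C2_derivatives S f D1 D2)"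

text \<open>The cost is a function of the pair \<open>(x, y)\<close>; only its values on \<open>closure X \<times> closure Y\<close> matter.\<close>

definition D_x :: "('a::real_normed_vector \<times> real \<Rightarrow> real) \<Rightarrow> 'a \<Rightarrow> real \<Rightarrow> 'a \<Rightarrow> real" where
  "D_x c x y = frechet_derivative (\<lambda>x'. c (x', y)) (at x)"

definition D_y :: "('a \<times> real \<Rightarrow> real) \<Rightarrow> 'a \<Rightarrow> real \<Rightarrow> real" where
  "D_y c x y = deriv (\<lambda>y'. c (x, y')) y"

text \<open>The covector obtained by differentiating \<open>D_x c\<close> in \<open>y\<close>, also at boundary points.\<close>

definition D2_xy ::
  "'a::real_normed_vector set \<Rightarrow> real set \<Rightarrow> ('a \<times> real \<Rightarrow> real) \<Rightarrow> 'a \<Rightarrow> real \<Rightarrow> 'a \<Rightarrow> real" where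
  "D2_xy X Y c x y =
     (\<lambda>v. blinfun_apply (blinfun_apply (second_derivative (X \<times> Y) c (x, y)) (0, 1)) (v, 0))"

definition twisted ::
  "'a::real_normed_vector set \<Rightarrow> real set \<Rightarrow> ('a \<times> real \<Rightarrow> real) \<Rightarrow> bool" where
  "twisted X Y c \<longleftrightarrow> (\<forall>x\<in>X. inj_on (\<lambda>y. D_x c x y) Y)"

definition nondegenerate ::
  "'a::real_normed_vector set \<Rightarrow> real set \<Rightarrow> ('a \<times> real \<Rightarrow> real) \<Rightarrow> bool" where
  "nondegenerate X Y c \<longleftrightarrow> (\<forall>x\<in>closure X. \<forall>y\<in>closure Y. D2_xy X Y c x y \<noteq> (\<lambda>v. 0))"

text \<open>Probability measures on a Borel set \<open>S\<close> are represented as Borel measures on the whole space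
  that give full mass to \<open>S\<close>.\<close>

definition prob_measures_on :: "'a::topological_space set \<Rightarrow> 'a measure set" where
  "prob_measures_on S = {\<mu>. sets \<mu> = sets borel \<and> prob_space \<mu> \<and> emeasure \<mu> S = 1}"

definition couplings ::
  "'a::topological_space measure \<Rightarrow> 'b::topological_space measure \<Rightarrow> ('a \<times> 'b) measure set" where
  "couplings \<mu> \<nu> =
     {\<gamma>. sets \<gamma> = sets borel \<and> distr \<gamma> borel fst = \<mu> \<and> distr \<gamma> borel snd = \<nu>}"

definition transport_cost ::
  "'a::topological_space set \<Rightarrow> real set \<Rightarrow> ('a \<times> real \<Rightarrow> real) \<Rightarrow> 'a measure \<Rightarrow> real measure \<Rightarrow> real"
where
  "transport_cost X Y c \<mu> \<nu> =
     (INF \<gamma>\<in>couplings \<mu> \<nu>. set_lebesgue_integral \<gamma> (closure X \<times> closure Y) c)"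

text \<open>The Lebesgue integral with values in the extended reals. The Bochner integral would assign
  the value 0, instead of \<open>\<infinity>\<close>, to functions whose positive part is not integrable.\<close>

definition extended_integral :: "'a measure \<Rightarrow> ('a \<Rightarrow> real) \<Rightarrow> ereal" where
  "extended_integral M f =
     enn2ereal (\<integral>\<^sup>+x. ennreal (f x) \<partial>M) - enn2ereal (\<integral>\<^sup>+x. ennreal (- f x) \<partial>M)"

definition density_of :: "'a::euclidean_space measure \<Rightarrow> 'a \<Rightarrow> real" where
  "density_of \<mu> x = enn2real (RN_deriv lborel \<mu> x)"

definition congestion :: "'a::euclidean_space set \<Rightarrow> (real \<Rightarrow> real) \<Rightarrow> 'a measure \<Rightarrow> ereal" where
  "congestion X g \<mu> =
     (if absolutely_continuous lborel \<mu>
      then extended_integral (restrict_space lborel X) (\<lambda>x. g (density_of \<mu> x))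
      else \<infinity>)"

definition total_cost ::
  "'a::euclidean_space set \<Rightarrow> real set \<Rightarrow> ('a \<times> real \<Rightarrow> real) \<Rightarrow> (real \<Rightarrow> real) \<Rightarrow> real measure \<Rightarrow>
     'a measure \<Rightarrow> ereal" where
  "total_cost X Y c g \<nu> \<mu> = ereal (transport_cost X Y c \<mu> \<nu>) + congestion X g \<mu>"

definition is_minimizer_on :: "'a set \<Rightarrow> ('a \<Rightarrow> ereal) \<Rightarrow> 'a \<Rightarrow> bool" where
  "is_minimizer_on A F a \<longleftrightarrow> a \<in> A \<and> (\<forall>b\<in>A. F a \<le> F b)"

definition strictly_convex_on :: "real set \<Rightarrow> (real \<Rightarrow> real) \<Rightarrow> bool" where
  "strictly_convex_on S g \<longleftrightarrow> convex S \<and>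
     (\<forall>s\<in>S. \<forall>t\<in>S. \<forall>u. s \<noteq> t \<and> 0 < u \<and> u < 1 \<longrightarrow>
        g ((1 - u) * s + u * t) < (1 - u) * g s + u * g t)"

definition deriv_inverse :: "(real \<Rightarrow> real) \<Rightarrow> real \<Rightarrow> real" where
  "deriv_inverse g = the_inv_into {0<..} (deriv g)"

definition K ::
  "'a::euclidean_space set \<Rightarrow> (real \<Rightarrow> real) \<Rightarrow> ('a \<Rightarrow> real) \<Rightarrow> real \<Rightarrow> real" where
  "K X g w =
     the_inv_into UNIV (\<lambda>z. set_lebesgue_integral lborel X (\<lambda>x. deriv_inverse g (z - w x)))"

text \<open>Levels are extended reals because \<open>k_max\<close> can be infinite.\<close>

definition X_eq :: "'a set \<Rightarrow> ('a \<times> real \<Rightarrow> real) \<Rightarrow> real \<Rightarrow> ereal \<Rightarrow> 'a set" where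
  "X_eq X c y k = {x\<in>X. ereal (D_y c x y) = k}"

definition X_ge :: "'a set \<Rightarrow> ('a \<times> real \<Rightarrow> real) \<Rightarrow> real \<Rightarrow> ereal \<Rightarrow> 'a set" where
  "X_ge X c y k = {x\<in>X. ereal (D_y c x y) \<ge> k}"

definition X_gt :: "'a set \<Rightarrow> ('a \<times> real \<Rightarrow> real) \<Rightarrow> real \<Rightarrow> ereal \<Rightarrow> 'a set" where
  "X_gt X c y k = X_ge X c y k - X_eq X c y k"

definition mass_splitting_level ::
  "'a set \<Rightarrow> real set \<Rightarrow> ('a \<times> real \<Rightarrow> real) \<Rightarrow> 'a measure \<Rightarrow> real measure \<Rightarrow> (real \<Rightarrow> real) \<Rightarrow> bool"
where
  "mass_splitting_level X Y c \<mu> \<nu> k \<longleftrightarrow>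
     (\<forall>y\<in>Y. emeasure \<mu> (X_ge X c y (ereal (k y))) = emeasure \<nu> {..y})"

text \<open>The measure \<open>\<mu>\<close> of the model enters only through the mass-splitting level \<open>k\<close>.\<close>

definition nested ::
  "'a set \<Rightarrow> real set \<Rightarrow> ('a \<times> real \<Rightarrow> real) \<Rightarrow> real measure \<Rightarrow> (real \<Rightarrow> real) \<Rightarrow> bool" where
  "nested X Y c \<nu> k \<longleftrightarrow>
     (\<forall>y0\<in>Y. \<forall>y1\<in>Y. y0 < y1 \<longrightarrow> emeasure \<nu> {y0..y1} > 0 \<longrightarrow>
        X_ge X c y0 (ereal (k y0)) \<subseteq> X_gt X c y1 (ereal (k y1)))"

definition k_max :: "'a set \<Rightarrow> ('a \<times> real \<Rightarrow> real) \<Rightarrow> real \<Rightarrow> real \<Rightarrow> real \<Rightarrow> ereal" where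
  "k_max X c y0 y1 k0 =
     (SUP k\<in>{k::real. X_ge X c y0 (ereal k0) \<subseteq> X_ge X c y1 (ereal k)}. ereal k)"

definition D_vol_min ::
  "'a::euclidean_space set \<Rightarrow> ('a \<times> real \<Rightarrow> real) \<Rightarrow> real \<Rightarrow> real \<Rightarrow> real \<Rightarrow> real" where
  "D_vol_min X c y0 y1 k0 =
     measure lborel (X_ge X c y1 (k_max X c y0 y1 k0) - X_ge X c y0 (ereal k0))"

end

theory Submission
  imports Defs
begin

text \<open>Comparing a minimizer with competitors obtained by moving a little mass gives, without duality,
  an upper bound on its density: transporting mass from \<open>x\<close> to \<open>x'\<close> changes the transport
  cost by at most \<open>M\<^sub>c (|x| + |x'|)\<close> per unit, so \<open>g'(density) - M\<^sub>c |x|\<close> cannot exceed the constant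
  for which \<open>(g')\<^sup>-\<^sup>1(constant - M\<^sub>c |x'|)\<close> has total mass 1. With this bound the hypothesis says that
  \<open>\<mu>\<close> gives less mass than \<open>\<nu>([y0, y1])\<close> to the set by which the super-level set of \<open>y0\<close> must
  grow before a super-level set of \<open>y1\<close> can fail to contain it, so \<open>k(y1)\<close> lies strictly below
  the level \<open>k_max\<close> and nestedness follows.\<close>

section \<open>The congestion function\<close>

text \<open>The estimate by \<open>norm x + norm x'\<close>, coarser than
  \<open>norm (x - x')\<close>, splits into one term for the place that loses mass and one for the
  place that gains it, so each can be set against the marginal congestion cost at its own point. The
  constant \<open>K X g (\<lambda>x. M * norm x) 1\<close> makes the two sides match. The profile
  with the minus sign has total mass 1, while the density has mass at most 1 on \<open>X\<close>;
  hence an excess over the profile with the plus sign forces at least as much deficit below the one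
  with the minus sign. The constant then cancels, because equal masses are removed and added. The
  obstacle is that the density may vanish, and nothing is assumed about a derivative of
  \<open>g\<close> at 0. Tangent lines are therefore drawn at the new density instead of the old
  one. For this to give the right marginal costs, the new density must not cross either profile,
  which is why only part of the excess is moved.\<close>

lemma finite_measure_restrict_lborel:
  fixes X :: "'a::euclidean_space set"
  assumes "open X" "bounded X"
  shows "finite_measure (restrict_space lborel X)"
  by (rule finite_measureI)
    (use assms emeasure_bounded_finite[of X] in \<open>simp add: emeasure_restrict_space space_restrict_space\<close>)

lemma measure_lborel_open_pos:
  fixes X :: "'a::euclidean_space set"
  assumes "open X" "bounded X" "X \<noteq> {}"
  shows "measure lborel X > 0"
proof -
  have "X \<in> lmeasurable" using assms by (intro bounded_set_imp_lmeasurable) auto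
  then have "measure lebesgue X \<noteq> 0"
    using open_not_negligible[OF assms(1,3)] by (simp add: negligible_iff_measure0)
  then show ?thesis using assms(1) by (simp add: less_le)
qed

text \<open>Convexity includes the endpoint 0, but differentiability does not; facts about
  \<open>deriv g\<close> below therefore concern positive arguments. The growth condition controls
  \<open>deriv g\<close> from above, the limit at 0 from below.\<close>

locale congestion_function =
  fixes g :: "real \<Rightarrow> real"
  assumes diff: "\<And>s. s > 0 \<Longrightarrow> g field_differentiable (at s)"
    and deriv_cont: "continuous_on {0<..} (deriv g)"
    and strict_convex: "strictly_convex_on {0..} g"
    and superlinear: "filterlim (\<lambda>s. g s / s) at_top at_top"
    and deriv_at_0: "filterlim (deriv g) at_bot (at_right 0)"
begin

lemma convex: "convex_on {0..} g"
proof (rule convex_onI)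
  fix t x y :: real assume "0 < t" "t < 1" "x \<in> {0..}" "y \<in> {0..}"
  then show "g ((1 - t) *\<^sub>R x + t *\<^sub>R y) \<le> (1 - t) * g x + t * g y"
  proof (cases "x = y")
    case True
    then show ?thesis by (simp add: algebra_simps)
  next
    case False
    with \<open>0 < t\<close> \<open>t < 1\<close> \<open>x \<in> {0..}\<close> \<open>y \<in> {0..}\<close> have "g ((1 - t) * x + t * y) < (1 - t) * g x + t * g y"
      using strict_convex unfolding strictly_convex_on_def by blast
    then show ?thesis by simp
  qed
qed simp

lemma has_deriv: "s > 0 \<Longrightarrow> (g has_field_derivative deriv g s) (at s)"
  by (rule field_differentiable_derivI[OF diff])

text \<open>The point of tangency is positive but \<open>s = 0\<close> is allowed, so that vanishing
  densities are covered.\<close>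

lemma above_tangent:
  assumes "t > 0" "s \<ge> 0"
  shows "g t + deriv g t * (s - t) \<le> g s"
proof -
  have "deriv g t * (s - t) \<le> g s - g t"
    by (rule convex_on_imp_above_tangent[OF convex])
      (use assms has_deriv[of t] in \<open>auto intro: has_field_derivative_at_within is_interval_connected\<close>)
  then show ?thesis by simp
qed

text \<open>The weak inequality is applied at the midpoint of \<open>s\<close> and \<open>t\<close>;
  strict convexity on the segment then makes it strict.\<close>

lemma above_tangent_strict:
  assumes "t > 0" "s \<ge> 0" "s \<noteq> t"
  shows "g t + deriv g t * (s - t) < g s"
proof -
  have "g t + deriv g t * ((s + t)/2 - t) \<le> g ((s + t)/2)"
    using assms by (intro above_tangent) auto
  also have "\<dots> = g ((1 - 1/2) * s + (1/2) * t)" by (simp add: field_simps)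
  also have "\<dots> < (1 - 1/2) * g s + (1/2) * g t"
    using strict_convex[unfolded strictly_convex_on_def, THEN conjunct2, rule_format, of s t "1/2"] assms
    by simp
  finally show ?thesis by (simp add: field_simps)
qed

text \<open>Adding the strict tangent inequalities at \<open>s\<close> and at \<open>t\<close>
  eliminates the values of \<open>g\<close>.\<close>

lemma deriv_strict_mono:
  assumes "0 < s" "s < t" shows "deriv g s < deriv g t"
proof -
  have "g t + deriv g t * (s - t) < g s" "g s + deriv g s * (t - s) < g t"
    using assms by (auto intro!: above_tangent_strict)
  then have "deriv g s * (t - s) < deriv g t * (t - s)" by (simp add: algebra_simps)
  then show ?thesis using assms by simp
qed

text \<open>The slope of the secant from 1 to \<open>s\<close> is a lower bound for
  \<open>deriv g s\<close>, and superlinear growth pushes it above \<open>z\<close>. In the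
  threshold, \<open>\<bar>g 1\<bar>\<close> absorbs the value at 1 and \<open>\<bar>z\<bar>\<close>
  absorbs \<open>z * (s - 1)\<close>.\<close>

lemma deriv_unbounded_above: "\<exists>s>0. z < deriv g s"
proof -
  have "\<forall>\<^sub>F s in at_top. g s / s > \<bar>z\<bar> + \<bar>g 1\<bar> + 1"
    using superlinear by (simp add: filterlim_at_top_dense)
  moreover have "\<forall>\<^sub>F s in at_top. (s::real) > 1" by (rule eventually_gt_at_top)
  ultimately have "\<forall>\<^sub>F s in at_top. s > 1 \<and> g s / s > \<bar>z\<bar> + \<bar>g 1\<bar> + 1"
    by eventually_elim auto
  then obtain s where s: "s > 1" "g s / s > \<bar>z\<bar> + \<bar>g 1\<bar> + 1"
    using eventually_happens'[of at_top] by force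
  have "g s > (\<bar>z\<bar> + \<bar>g 1\<bar> + 1) * s" using s by (simp add: field_simps)
  moreover have "\<bar>g 1\<bar> * s \<ge> \<bar>g 1\<bar>" using s by (simp add: mult_le_cancel_left1)
  moreover have "\<bar>z\<bar> * s \<ge> z * (s - 1)" using s by (smt (verit) mult_right_mono mult_left_mono abs_ge_self abs_ge_zero)
  ultimately have "g s - g 1 > z * (s - 1)" using s by (simp add: algebra_simps)
  moreover have "g s + deriv g s * (1 - s) \<le> g 1" using s by (intro above_tangent) auto
  ultimately have "z * (s - 1) < deriv g s * (s - 1)" by (simp add: algebra_simps)
  with s show ?thesis by (intro exI[of _ s]) auto
qed

lemma deriv_unbounded_below: "\<exists>s>0. deriv g s < z"
proof -
  have "\<forall>\<^sub>F s in at_right 0. deriv g s < z"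
    using deriv_at_0 by (simp add: filterlim_at_bot_dense)
  then show ?thesis
    unfolding eventually_at_right_field
    by (metis field_lbound_gt_zero zero_less_one)
qed

text \<open>This makes the \<open>the_inv_into\<close> behind \<open>deriv_inverse\<close> a genuine
  inverse, defined for every real argument.\<close>

lemma deriv_bij: "bij_betw (deriv g) {0<..} UNIV"
  unfolding bij_betw_def
proof
  show "inj_on (deriv g) {0<..}"
    by (rule linorder_inj_onI) (auto dest: deriv_strict_mono)
  have "z \<in> deriv g ` {0<..}" for z
  proof -
    obtain a b where ab: "a > 0" "deriv g a < z" "b > 0" "z < deriv g b"
      using deriv_unbounded_above deriv_unbounded_below by blast
    have "a \<le> b" using ab deriv_strict_mono[of b a] by force
    moreover have "continuous_on {a..b} (deriv g)"
      by (rule continuous_on_subset[OF deriv_cont]) (use ab in auto)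
    ultimately obtain x where "a \<le> x" "deriv g x = z"
      using IVT'[of "deriv g" a z b] ab by auto
    then show ?thesis using ab by force
  qed
  then show "deriv g ` {0<..} = UNIV" by blast
qed

lemma deriv_inverse_pos: "deriv_inverse g z > 0"
  and deriv_deriv_inverse: "deriv g (deriv_inverse g z) = z"
  using the_inv_into_into[of "deriv g" "{0<..}" z "{0<..}"] f_the_inv_into_f[of "deriv g" "{0<..}" z] deriv_bij
  unfolding deriv_inverse_def bij_betw_def by auto

lemma deriv_less_iff: "0 < s \<Longrightarrow> 0 < t \<Longrightarrow> deriv g s < deriv g t \<longleftrightarrow> s < t"
  using deriv_strict_mono by (metis linorder_neqE_linordered_idom order_less_asym)

lemma deriv_inverse_strict_mono: "strict_mono (deriv_inverse g)"
  by (rule strict_monoI) (metis deriv_less_iff deriv_inverse_pos deriv_deriv_inverse)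

lemma deriv_inverse_deriv: "s > 0 \<Longrightarrow> deriv_inverse g (deriv g s) = s"
  using deriv_bij unfolding deriv_inverse_def bij_betw_def by (simp add: the_inv_into_f_f)

lemma range_deriv_inverse: "range (deriv_inverse g) = {0<..}"
proof
  show "{0<..} \<subseteq> range (deriv_inverse g)"
    by (metis deriv_inverse_deriv greaterThan_iff rangeI subsetI)
qed (auto simp: deriv_inverse_pos)

text \<open>A monotone function with open range has no jumps.\<close>

lemma deriv_inverse_continuous: "continuous_on UNIV (deriv_inverse g)"
  by (rule continuous_onI_mono)
    (auto simp: range_deriv_inverse strict_mono_leD[OF deriv_inverse_strict_mono])

lemma deriv_inverse_measurable [measurable]: "deriv_inverse g \<in> borel_measurable borel"
  by (rule borel_measurable_continuous_onI[OF deriv_inverse_continuous])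

text \<open>The tangent at \<open>deriv_inverse g 0\<close> is horizontal, so \<open>g\<close> has
  its global minimum there. The bound later keeps the negative part of the congestion finite on the
  bounded set \<open>X\<close>.\<close>

lemma bounded_below: "\<exists>b\<ge>0. \<forall>s\<ge>0. - b \<le> g s"
proof -
  let ?t = "deriv_inverse g 0"
  have "g ?t \<le> g s" if "s \<ge> 0" for s
    using above_tangent[OF deriv_inverse_pos that, of 0] by (simp add: deriv_deriv_inverse)
  then show ?thesis by (intro exI[of _ "\<bar>g ?t\<bar>"]) force
qed

text \<open>Convexity permits a jump of \<open>g\<close> at 0, and \<open>g\<close> is arbitrary on
  negative reals. It is therefore replaced by a function that is constant off \<open>{0<..}\<close>
  and agrees with it on the values of \<open>f\<close>.\<close>

lemma measurable_comp_nonneg: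
  assumes [measurable]: "f \<in> borel_measurable M" and "\<And>x. f x \<ge> 0"
  shows "(\<lambda>x. g (f x)) \<in> borel_measurable M"
proof -
  have "continuous_on {0<..} g"
    by (rule DERIV_continuous_on[OF has_field_derivative_at_within[OF has_deriv]]) simp
  then have [measurable]: "(\<lambda>s. if s \<in> {0<..} then g s else g 0) \<in> borel_measurable borel"
    by (intro borel_measurable_continuous_on_if) auto
  have "(\<lambda>x. (\<lambda>s. if s \<in> {0<..} then g s else g 0) (f x)) \<in> borel_measurable M"
    by measurable
  also have "(\<lambda>x. (\<lambda>s. if s \<in> {0<..} then g s else g 0) (f x)) = (\<lambda>x. g (f x))"
  proof
    fix x show "(if f x \<in> {0<..} then g (f x) else g 0) = g (f x)"
      using assms(2)[of x] by (cases "f x = 0") auto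
  qed
  finally show ?thesis .
qed


lemma level_integrable:
  fixes X :: "'a::euclidean_space set"
  assumes "open X" "bounded X"
  shows "integrable (restrict_space lborel X) (\<lambda>x. deriv_inverse g (z + a * norm x))"
proof -
  interpret finite_measure "restrict_space lborel X"
    using assms by (intro finite_measure_restrict_lborel)
  obtain R where R: "\<And>x. x \<in> X \<Longrightarrow> norm x \<le> R"
    using assms(2) unfolding bounded_iff by blast
  have "norm (deriv_inverse g (z + a * norm x)) \<le> deriv_inverse g (z + \<bar>a\<bar> * R)" if x: "x \<in> X" for x
  proof -
    have "a * norm x \<le> \<bar>a\<bar> * norm x" by (intro mult_right_mono) auto
    also have "\<dots> \<le> \<bar>a\<bar> * R" using R[OF x] by (intro mult_left_mono) auto
    finally show ?thesis
      using x deriv_inverse_pos[of "z + a * norm x"] strict_mono_leD[OF deriv_inverse_strict_mono] by simp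
  qed
  then show ?thesis
    by (intro integrable_const_bound[where B = "deriv_inverse g (z + \<bar>a\<bar> * R)"] AE_I2 measurable_restrict_space1)
      (auto simp: space_restrict_space)
qed

text \<open>\<open>K\<close> is a \<open>the_inv_into\<close>, so its value at 1 has the intended
  meaning only once the integral is shown to be injective in \<open>z\<close> and to attain 1.
  Strict monotonicity gives the first, the intermediate value theorem the second.\<close>

lemma K_eq:
  fixes X :: "'a::euclidean_space set"
  assumes X: "open X" "bounded X" "X \<noteq> {}" and M: "M \<ge> 0"
  shows "integral\<^sup>L (restrict_space lborel X)
      (\<lambda>x. deriv_inverse g (K X g (\<lambda>x. M * norm x) 1 - M * norm x)) = 1"
proof -
  define L where "L = restrict_space lborel X"
  define F where "F z = integral\<^sup>L L (\<lambda>x. deriv_inverse g (z - M * norm x))" for z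
  interpret finite_measure L
    unfolding L_def using X by (intro finite_measure_restrict_lborel)
  note mono = strict_monoD[OF deriv_inverse_strict_mono] strict_mono_leD[OF deriv_inverse_strict_mono]
  have spL [simp]: "space L = X" by (simp add: L_def space_restrict_space)
  have pos: "measure L X > 0"
    using X by (simp add: L_def measure_restrict_space measure_lborel_open_pos)
  obtain R where R: "\<And>x. x \<in> X \<Longrightarrow> norm x \<le> R"
    using X(2) unfolding bounded_iff by blast
  have int: "integrable L (\<lambda>x. deriv_inverse g (z - M * norm x))" for z
    using level_integrable[OF X(1,2), of z "- M"] by (simp add: L_def)
  have emL: "emeasure L (space L) \<noteq> 0"
    using pos by (metis measure_eq_emeasure_eq_ennreal enn2real_0 less_irrefl measure_def spL)
  have F_mono: "F a < F b" if "a < b" for a b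
    unfolding F_def using that emL by (intro integral_less_AE_space int AE_I2 mono(1)) auto
  have seq: "(\<lambda>n. F (u n)) \<longlonglongrightarrow> F z" if u: "u \<longlonglongrightarrow> z" for u z
  proof -
    \<comment> \<open>A bound for the convergent sequence becomes, by monotonicity of
      \<open>deriv_inverse g\<close>, an integrable dominating function.\<close>
    obtain B where B: "\<And>n. u n \<le> B"
      using convergent_imp_Bseq[OF convergentI[OF u]] unfolding Bseq_def by (force simp: abs_le_iff)
    show ?thesis unfolding F_def
    proof (rule integral_dominated_convergence[where w = "\<lambda>x. deriv_inverse g (B - M * norm x)"])
      show "AE x in L. (\<lambda>n. deriv_inverse g (u n - M * norm x)) \<longlonglongrightarrow> deriv_inverse g (z - M * norm x)"
        by (intro AE_I2 continuous_on_tendsto_compose[OF deriv_inverse_continuous] tendsto_diff u tendsto_const) auto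
      show "AE x in L. norm (deriv_inverse g (u n - M * norm x)) \<le> deriv_inverse g (B - M * norm x)" for n
        using B[of n] mono(2) by (intro AE_I2) (simp add: deriv_inverse_pos abs_of_pos)
    qed (use int in auto)
  qed
  have cont: "continuous_on S F" for S
    unfolding continuous_on_sequentially using seq by (auto simp: comp_def)
  \<comment> \<open>The constant profile of height \<open>?v\<close> has mass 1 on \<open>X\<close>.
    Since \<open>0 \<le> M * norm x \<le> M * R\<close> there, the profile of level
    \<open>?a\<close> lies below it and the one of level \<open>?b\<close> above it.\<close>
  let ?v = "1 / measure L X"
  let ?a = "deriv g ?v" and ?b = "deriv g ?v + M * R"
  have "F ?a \<le> integral\<^sup>L L (\<lambda>x. ?v)"
  proof -
    have "deriv_inverse g (?a - M * norm x) \<le> ?v" for x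
      using mono(2)[of "?a - M * norm x" ?a] M pos by (simp add: deriv_inverse_deriv)
    then show ?thesis unfolding F_def by (intro integral_mono int) auto
  qed
  then have Fa: "F ?a \<le> 1" using pos by simp
  have "integral\<^sup>L L (\<lambda>x. ?v) \<le> F ?b"
  proof -
    have "?v \<le> deriv_inverse g (?b - M * norm x)" if "x \<in> X" for x
      using mono(2)[of ?a "?b - M * norm x"] mult_left_mono[OF R[OF that] M] pos
      by (simp add: deriv_inverse_deriv)
    then show ?thesis unfolding F_def by (intro integral_mono int) auto
  qed
  then have Fb: "1 \<le> F ?b" using pos by simp
  have "?a \<le> ?b"
  proof -
    obtain x where "x \<in> X" using X by auto
    with R[of x] M show ?thesis by (auto intro: mult_nonneg_nonneg order_trans[OF norm_ge_zero])
  qed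
  then obtain z where z: "F z = 1"
    using IVT'[OF Fa Fb _ cont] by blast
  have "inj F" using F_mono by (intro linorder_injI) (metis less_irrefl)
  have "K X g (\<lambda>x. M * norm x) = the_inv F"
    unfolding K_def F_def L_def using X(1)
    by (simp add: set_lebesgue_integral_def integral_restrict_space)
  then have "K X g (\<lambda>x. M * norm x) 1 = z"
    using the_inv_f_f[OF \<open>inj F\<close>, of z] z by simp
  then show ?thesis using z unfolding F_def L_def by simp
qed
end

section \<open>Moving mass in a transport plan\<close>

text \<open>The first component \<open>x\<close> of a pair drawn from \<open>\<gamma>\<close> is replaced, with probability \<open>f x\<close>, by
  an independent draw from \<open>q\<close>; the boolean records whether it is replaced.\<close>

definition move_mass :: "('a \<Rightarrow> real) \<Rightarrow> 'a measure \<Rightarrow> ('a::euclidean_space \<times> real) measure \<Rightarrow> ('a \<times> real) measure"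
  where
  "move_mass f q \<gamma> =
     distr (density ((\<gamma> \<Otimes>\<^sub>M q) \<Otimes>\<^sub>M count_space (UNIV :: bool set))
         (\<lambda>z. ennreal (if snd z then f (fst (fst (fst z))) else 1 - f (fst (fst (fst z))))))
       borel (\<lambda>z. if snd z then (snd (fst z), snd (fst (fst z))) else fst (fst z))"

lemma sets_move_mass [simp]: "sets (move_mass f q \<gamma>) = sets borel"
  by (simp add: move_mass_def)

text \<open>Summing over the boolean leaves one term for replacement and one for staying. Both
  marginals and the transport cost are read off by choosing \<open>\<phi>\<close>.\<close>

lemma nn_integral_move_mass:
  fixes f :: "'a::euclidean_space \<Rightarrow> real"
  assumes "sets \<gamma> = sets borel" and [measurable_cong]: "sets q = sets borel"
    and "sigma_finite_measure q"
    and "f \<in> borel_measurable borel" "\<phi> \<in> borel_measurable borel"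
  shows "integral\<^sup>N (move_mass f q \<gamma>) \<phi> =
    (\<integral>\<^sup>+p. \<integral>\<^sup>+x. ennreal (f (fst p)) * \<phi> (x, snd p) + ennreal (1 - f (fst p)) * \<phi> p \<partial>q \<partial>\<gamma>)"
proof -
  interpret q: sigma_finite_measure q by fact
  interpret b: sigma_finite_measure "count_space (UNIV :: bool set)"
    by (rule sigma_finite_measure_count_space_finite) simp
  let ?N = "(\<gamma> \<Otimes>\<^sub>M q) \<Otimes>\<^sub>M count_space (UNIV :: bool set)"
  define w where "w z = ennreal (if snd z then f (fst (fst (fst z))) else 1 - f (fst (fst (fst z))))"
    for z :: "(('a \<times> real) \<times> 'a) \<times> bool"
  define h where "h z = (if snd z then (snd (fst z), snd (fst (fst z))) else fst (fst z))"
    for z :: "(('a \<times> real) \<times> 'a) \<times> bool"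
  have sets_\<gamma> [measurable_cong]: "sets \<gamma> = sets (borel \<Otimes>\<^sub>M borel)"
    by (subst borel_prod) (rule assms(1))
  have "\<phi> \<in> borel_measurable (borel \<Otimes>\<^sub>M borel)"
    using assms(5) by (simp add: borel_prod)
  note [measurable] = assms(4) this
  have [measurable]: "w \<in> borel_measurable ?N"
    unfolding w_def by measurable
  have "h \<in> measurable ?N (borel \<Otimes>\<^sub>M borel)"
    unfolding h_def by measurable
  then have h: "h \<in> measurable ?N borel" by (simp add: borel_prod)
  have [measurable]: "(\<lambda>z. \<phi> (h z)) \<in> borel_measurable ?N"
    using h assms(5) by (rule measurable_compose)
  have [measurable]: "\<phi> \<in> borel_measurable \<gamma>"
    using assms(5) measurable_cong_sets[OF assms(1) refl] by blast
  have [measurable]: "(\<lambda>a. \<phi> (fst a)) \<in> borel_measurable (\<gamma> \<Otimes>\<^sub>M q)"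
    by (rule measurable_compose[OF measurable_fst]) measurable
  have "integral\<^sup>N (move_mass f q \<gamma>) \<phi> = (\<integral>\<^sup>+z. w z * \<phi> (h z) \<partial>?N)"
    unfolding move_mass_def w_def[symmetric] h_def[symmetric]
    using h assms(5) by (simp add: nn_integral_distr nn_integral_density)
  also have "\<dots> = (\<integral>\<^sup>+a. \<integral>\<^sup>+b. w (a, b) * \<phi> (h (a, b)) \<partial>count_space UNIV \<partial>(\<gamma> \<Otimes>\<^sub>M q))"
    by (rule b.nn_integral_fst[symmetric]) measurable
  also have "\<dots> = (\<integral>\<^sup>+a. ennreal (f (fst (fst a))) * \<phi> (snd a, snd (fst a))
      + ennreal (1 - f (fst (fst a))) * \<phi> (fst a) \<partial>(\<gamma> \<Otimes>\<^sub>M q))"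
    by (simp add: nn_integral_count_space_finite UNIV_bool w_def h_def add.commute)
  also have "\<dots> = (\<integral>\<^sup>+p. \<integral>\<^sup>+x. ennreal (f (fst p)) * \<phi> (x, snd p)
      + ennreal (1 - f (fst p)) * \<phi> p \<partial>q \<partial>\<gamma>)"
    by (subst q.nn_integral_fst[symmetric]) auto
  finally show ?thesis .
qed

text \<open>\<open>couplings\<close> mentions neither total mass nor supports; both are inherited
  from the marginals.\<close>

lemma couplingsD:
  assumes "\<gamma> \<in> couplings \<mu> \<nu>" "\<mu> \<in> prob_measures_on S" "\<nu> \<in> prob_measures_on T"
  shows "sets \<gamma> = sets borel" "prob_space \<gamma>" "AE p in \<gamma>. p \<in> S \<times> T"
proof -
  show 1: "sets \<gamma> = sets borel" using assms(1) by (simp add: couplings_def)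
  have m: "fst \<in> measurable \<gamma> borel" "snd \<in> measurable \<gamma> borel"
    unfolding measurable_cong_sets[OF 1 refl]
    by (intro borel_measurable_continuous_onI continuous_intros continuous_on_fst continuous_on_snd)+
  have d: "distr \<gamma> borel fst = \<mu>" "distr \<gamma> borel snd = \<nu>" using assms(1) by (simp_all add: couplings_def)
  interpret \<mu>: prob_space \<mu> using assms(2) by (simp add: prob_measures_on_def)
  interpret \<nu>: prob_space \<nu> using assms(3) by (simp add: prob_measures_on_def)
  show "prob_space \<gamma>" using prob_space_distrD[OF m(1)] d \<mu>.prob_space_axioms by simp
  have "AE x in \<mu>. x \<in> S"
    using assms(2) \<mu>.AE_prob_1[of S] by (simp add: prob_measures_on_def measure_def)
  then have "AE p in \<gamma>. fst p \<in> S" unfolding d(1)[symmetric] by (rule AE_distrD[OF m(1)])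
  moreover have "AE x in \<nu>. x \<in> T"
    using assms(3) \<nu>.AE_prob_1[of T] by (simp add: prob_measures_on_def measure_def)
  then have "AE p in \<gamma>. snd p \<in> T" unfolding d(2)[symmetric] by (rule AE_distrD[OF m(2)])
  ultimately show "AE p in \<gamma>. p \<in> S \<times> T" by eventually_elim (auto simp: mem_Times_iff)
qed

text \<open>The product plan shows that the infimum in \<open>transport_cost\<close> is over a
  nonempty set.\<close>

lemma pair_measure_in_couplings:
  fixes \<mu> :: "'a::euclidean_space measure" and \<nu> :: "real measure"
  assumes "prob_space \<mu>" "prob_space \<nu>" and s: "sets \<mu> = sets borel" "sets \<nu> = sets borel"
  shows "\<mu> \<Otimes>\<^sub>M \<nu> \<in> couplings \<mu> \<nu>"
proof -
  interpret \<mu>: prob_space \<mu> by fact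
  interpret \<nu>: prob_space \<nu> by fact
  interpret pair_prob_space \<mu> \<nu> ..
  have "distr (\<mu> \<Otimes>\<^sub>M \<nu>) borel fst = distr (\<mu> \<Otimes>\<^sub>M \<nu>) \<mu> fst" "distr (\<mu> \<Otimes>\<^sub>M \<nu>) borel snd = distr (\<mu> \<Otimes>\<^sub>M \<nu>) \<nu> snd"
    using s by (auto intro!: distr_cong)
  moreover have "distr (\<mu> \<Otimes>\<^sub>M \<nu>) \<mu> fst = \<mu>" by (rule \<nu>.distr_pair_fst)
  moreover have "distr (\<mu> \<Otimes>\<^sub>M \<nu>) \<nu> snd = \<nu>"
  proof (rule measure_eqI)
    fix A assume A: "A \<in> sets (distr (\<mu> \<Otimes>\<^sub>M \<nu>) \<nu> snd)"
    then have "snd -` A \<inter> space (\<mu> \<Otimes>\<^sub>M \<nu>) = space \<mu> \<times> A"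
      using sets.sets_into_space[of A \<nu>] by (auto simp: space_pair_measure)
    with A show "emeasure (distr (\<mu> \<Otimes>\<^sub>M \<nu>) \<nu> snd) A = emeasure \<nu> A"
      by (simp add: emeasure_distr \<nu>.emeasure_pair_measure_Times \<mu>.emeasure_space_1)
  qed simp
  moreover have "sets (\<mu> \<Otimes>\<^sub>M \<nu>) = sets borel"
    by (subst borel_prod[symmetric]) (rule sets_pair_measure_cong[OF s])
  ultimately show ?thesis by (simp add: couplings_def)
qed

text \<open>The second component is kept in either case and the weights \<open>f\<close> and
  \<open>1 - f\<close> add up to 1, so the second marginal survives. The first marginal is specified
  by its masses of sets, so that a competitor given by an explicit density can be inserted.\<close>

lemma move_mass_in_couplings:
  fixes \<mu> \<mu>' :: "'a::euclidean_space measure" and \<nu> :: "real measure"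
  assumes \<gamma>: "\<gamma> \<in> couplings \<mu> \<nu>"
    and s: "sets q = sets borel" "sets \<mu>' = sets borel" and "prob_space q"
    and f [measurable]: "f \<in> borel_measurable borel" and f01: "\<And>x. 0 \<le> f x" "\<And>x. f x \<le> 1"
    and \<mu>': "\<And>A. A \<in> sets borel \<Longrightarrow> emeasure \<mu>' A =
      (\<integral>\<^sup>+x. ennreal (f x) * emeasure q A + ennreal (1 - f x) * indicator A x \<partial>\<mu>)"
  shows "move_mass f q \<gamma> \<in> couplings \<mu>' \<nu>"
proof -
  interpret q: prob_space q by fact
  have sg: "sets \<gamma> = sets borel" using \<gamma> by (simp add: couplings_def)
  have c: "fst \<in> measurable borel (borel :: 'a measure)" "snd \<in> measurable borel (borel :: real measure)"
    by (intro borel_measurable_continuous_onI continuous_intros continuous_on_fst continuous_on_snd)+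
  then have m: "fst \<in> measurable \<gamma> (borel :: 'a measure)" "snd \<in> measurable \<gamma> (borel :: real measure)"
    unfolding measurable_cong_sets[OF sg refl] .
  have m': "fst \<in> measurable (move_mass f q \<gamma>) (borel :: 'a measure)" "snd \<in> measurable (move_mass f q \<gamma>) (borel :: real measure)"
    using c unfolding measurable_cong_sets[OF sets_move_mass refl] .
  note nn = nn_integral_move_mass[OF sg s(1) q.sigma_finite_measure_axioms f]
  have "distr (move_mass f q \<gamma>) borel fst = \<mu>'"
  proof (rule measure_eqI)
    fix A assume "A \<in> sets (distr (move_mass f q \<gamma>) borel fst)"
    then have A [measurable]: "A \<in> sets borel" by simp
    have "emeasure (distr (move_mass f q \<gamma>) borel fst) A = (\<integral>\<^sup>+p. indicator A (fst p) \<partial>move_mass f q \<gamma>)"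
      by (simp add: nn_integral_distr[OF m'(1), symmetric])
    also have "\<dots> = (\<integral>\<^sup>+p. \<integral>\<^sup>+x. ennreal (f (fst p)) * indicator A x + ennreal (1 - f (fst p)) * indicator A (fst p) \<partial>q \<partial>\<gamma>)"
      by (subst nn) (auto intro!: measurable_compose[OF c(1)])
    also have "\<dots> = (\<integral>\<^sup>+p. ennreal (f (fst p)) * emeasure q A + ennreal (1 - f (fst p)) * indicator A (fst p) \<partial>\<gamma>)"
      using s(1) by (simp add: nn_integral_add nn_integral_cmult q.emeasure_space_1)
    also have "\<dots> = (\<integral>\<^sup>+x. ennreal (f x) * emeasure q A + ennreal (1 - f x) * indicator A x \<partial>distr \<gamma> borel fst)"
      by (simp add: nn_integral_distr[OF m(1)])
    also have "\<dots> = emeasure \<mu>' A"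
      using \<gamma> \<mu>'[OF A] by (simp add: couplings_def)
    finally show "emeasure (distr (move_mass f q \<gamma>) borel fst) A = emeasure \<mu>' A" .
  qed (simp add: s)
  moreover have "distr (move_mass f q \<gamma>) borel snd = \<nu>"
  proof (rule measure_eqI)
    fix A assume "A \<in> sets (distr (move_mass f q \<gamma>) borel snd)"
    then have A [measurable]: "A \<in> sets borel" by simp
    have "emeasure (distr (move_mass f q \<gamma>) borel snd) A = (\<integral>\<^sup>+p. indicator A (snd p) \<partial>move_mass f q \<gamma>)"
      by (simp add: nn_integral_distr[OF m'(2), symmetric])
    also have "\<dots> = (\<integral>\<^sup>+p. \<integral>\<^sup>+x. ennreal (f (fst p)) * indicator A (snd p) + ennreal (1 - f (fst p)) * indicator A (snd p) \<partial>q \<partial>\<gamma>)"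
      by (subst nn) (auto intro!: measurable_compose[OF c(2)])
    also have "\<dots> = (\<integral>\<^sup>+p. indicator A (snd p) \<partial>\<gamma>)"
      using f01 by (simp add: q.emeasure_space_1 distrib_right[symmetric] ennreal_plus[symmetric] del: ennreal_plus)
    also have "\<dots> = (\<integral>\<^sup>+x. indicator A x \<partial>distr \<gamma> borel snd)"
      by (subst nn_integral_distr[OF m(2)]) auto
    also have "\<dots> = emeasure \<nu> A"
      using \<gamma> by (auto simp: couplings_def)
    finally show "emeasure (distr (move_mass f q \<gamma>) borel snd) A = emeasure \<nu> A" .
  qed (use \<gamma> in \<open>auto simp: couplings_def\<close>)
  ultimately show ?thesis by (simp add: couplings_def)
qed

text \<open>Adding \<open>B\<close> makes the cost nonnegative on \<open>D\<close>, which allows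
  plans to be compared by \<open>nn_integral\<close>; the indicator hides the arbitrary values of
  \<open>c\<close> off \<open>D\<close>. The second claim supplies the lower bound that a
  real-valued infimum requires.\<close>

lemma nn_integral_cost:
  fixes c :: "'a::euclidean_space \<times> real \<Rightarrow> real"
  assumes "prob_space \<gamma>" and s: "sets \<gamma> = sets borel" and D: "AE p in \<gamma>. p \<in> D"
    and c: "closed D" "continuous_on D c" "\<And>p. p \<in> D \<Longrightarrow> \<bar>c p\<bar> \<le> B"
  shows "(\<integral>\<^sup>+p. ennreal (indicator D p * (c p + B)) \<partial>\<gamma>) = ennreal (set_lebesgue_integral \<gamma> D c + B)"
    and "- B \<le> set_lebesgue_integral \<gamma> D c"
proof -
  interpret prob_space \<gamma> by fact
  have "(\<lambda>p. indicator D p *\<^sub>R c p) \<in> borel_measurable borel"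
    using c by (intro borel_measurable_continuous_on_indicator) auto
  then have m [measurable]: "(\<lambda>p. indicator D p *\<^sub>R c p) \<in> borel_measurable \<gamma>"
    using measurable_cong_sets[OF s refl] by blast
  have DE [measurable]: "D \<in> events" using c(1) s by simp
  have "D \<noteq> {}" using D by auto
  then have B: "B \<ge> 0" using c(3) by force
  have int: "integrable \<gamma> (\<lambda>p. indicator D p *\<^sub>R c p)"
    using c(3) B by (intro integrable_const_bound[where B = B] AE_I2 m) (auto simp: indicator_def)
  then have int': "integrable \<gamma> (\<lambda>p. indicator D p *\<^sub>R c p + B)" by simp
  have "(\<integral>\<^sup>+p. ennreal (indicator D p * (c p + B)) \<partial>\<gamma>) = (\<integral>\<^sup>+p. ennreal (indicator D p *\<^sub>R c p + B) \<partial>\<gamma>)"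
    using D by (intro nn_integral_cong_AE) (auto elim!: eventually_mono)
  also have "\<dots> = ennreal (\<integral>p. indicator D p *\<^sub>R c p + B \<partial>\<gamma>)"
    using c(3) B by (intro nn_integral_eq_integral int' AE_I2) (force simp: indicator_def abs_le_iff)
  also have "(\<integral>p. indicator D p *\<^sub>R c p + B \<partial>\<gamma>) = set_lebesgue_integral \<gamma> D c + B"
    using int by (simp add: set_lebesgue_integral_def prob_space)
  finally show "(\<integral>\<^sup>+p. ennreal (indicator D p * (c p + B)) \<partial>\<gamma>) = ennreal (set_lebesgue_integral \<gamma> D c + B)" .
  have "0 \<le> (\<integral>p. indicator D p *\<^sub>R c p + B \<partial>\<gamma>)"
    using c(3) B by (intro integral_nonneg_AE AE_I2) (force simp: indicator_def abs_le_iff)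
  then show "- B \<le> set_lebesgue_integral \<gamma> D c"
    using int by (simp add: set_lebesgue_integral_def prob_space)
qed

lemma move_mass_in_prob_measures_on:
  fixes \<mu> \<mu>' :: "'a::euclidean_space measure"
  assumes S: "S \<in> sets borel"
    and \<mu>: "\<mu> \<in> prob_measures_on S" and q: "q \<in> prob_measures_on S" and s: "sets \<mu>' = sets borel"
    and f01: "\<And>x. 0 \<le> f x" "\<And>x. f x \<le> 1"
    and \<mu>': "\<And>A. A \<in> sets borel \<Longrightarrow> emeasure \<mu>' A =
      (\<integral>\<^sup>+x. ennreal (f x) * emeasure q A + ennreal (1 - f x) * indicator A x \<partial>\<mu>)"
  shows "\<mu>' \<in> prob_measures_on S"
proof -
  interpret \<mu>: prob_space \<mu> using \<mu> by (simp add: prob_measures_on_def)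
  interpret q: prob_space q using q by (simp add: prob_measures_on_def)
  have \<mu>S: "AE x in \<mu>. x \<in> S"
    using \<mu> \<mu>.AE_prob_1[of S] by (simp add: prob_measures_on_def measure_def)
  have 1: "emeasure \<mu>' A = 1" if A: "A \<in> sets borel" "S \<subseteq> A" "emeasure q A = 1" for A
  proof -
    have "emeasure \<mu>' A = (\<integral>\<^sup>+x. 1 \<partial>\<mu>)"
      unfolding \<mu>'[OF A(1)]
    proof (intro nn_integral_cong_AE, use \<mu>S in eventually_elim)
      fix x assume "x \<in> S"
      with A f01[of x] show "ennreal (f x) * emeasure q A + ennreal (1 - f x) * indicator A x = 1"
        by (auto simp: ennreal_plus[symmetric] simp del: ennreal_plus)
    qed
    then show ?thesis by (simp add: \<mu>.emeasure_space_1)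
  qed
  have "space q = UNIV" using q sets_eq_imp_space_eq[of q borel] by (simp add: prob_measures_on_def)
  moreover have "space \<mu>' = UNIV" using sets_eq_imp_space_eq[OF s] by simp
  ultimately show ?thesis
    using 1[of UNIV] 1[OF S] q q.emeasure_space_1 s by (auto simp: prob_measures_on_def intro: prob_spaceI)
qed

text \<open>Every plan for \<open>\<mu>\<close> yields a plan for \<open>\<mu>'\<close> that is
  dearer by at most \<open>e\<close>. The increment is the same for all plans because the new point
  is drawn independently and the bound \<open>M * (norm x + norm x')\<close> does not involve
  \<open>y\<close>; it depends only on \<open>\<mu>\<close>, \<open>f\<close> and \<open>q\<close>.
  Hence the estimate passes to the infimum.\<close>

lemma transport_cost_move_mass:
  fixes \<mu> \<mu>' :: "'a::euclidean_space measure" and \<nu> :: "real measure"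
  assumes "bounded X" "bounded Y"
    and c: "continuous_on (closure X \<times> closure Y) c"
    and lip: "\<And>y. y \<in> closure Y \<Longrightarrow> M-lipschitz_on (closure X) (\<lambda>x. c (x, y))"
    and \<mu>: "\<mu> \<in> prob_measures_on (closure X)" and \<nu>: "\<nu> \<in> prob_measures_on (closure Y)"
    and q: "q \<in> prob_measures_on (closure X)" and s: "sets \<mu>' = sets borel"
    and f [measurable]: "f \<in> borel_measurable borel" and f01: "\<And>x. 0 \<le> f x" "\<And>x. f x \<le> 1"
    and \<mu>': "\<And>A. A \<in> sets borel \<Longrightarrow> emeasure \<mu>' A =
      (\<integral>\<^sup>+x. ennreal (f x) * emeasure q A + ennreal (1 - f x) * indicator A x \<partial>\<mu>)"
    and e: "(\<integral>\<^sup>+x. ennreal (f x) * (\<integral>\<^sup>+x'. ennreal (M * (norm x + norm x')) \<partial>q) \<partial>\<mu>) \<le> ennreal e" "e \<ge> 0"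
  shows "transport_cost X Y c \<mu>' \<nu> \<le> transport_cost X Y c \<mu> \<nu> + e"
proof -
  have \<mu>'P: "\<mu>' \<in> prob_measures_on (closure X)"
    by (rule move_mass_in_prob_measures_on[OF _ \<mu> q s f01 \<mu>']) simp
  define D where "D = closure X \<times> closure Y"
  have "compact D" unfolding D_def using assms by (intro compact_Times) (auto simp: compact_closure)
  then have "closed D" by (rule compact_imp_closed)
  have cD: "continuous_on D c" using c by (simp add: D_def)
  obtain B where B: "\<And>p. p \<in> D \<Longrightarrow> \<bar>c p\<bar> \<le> B"
    using compact_imp_bounded[OF compact_continuous_image[OF cD \<open>compact D\<close>]]
    unfolding bounded_iff by force
  define \<phi> where "\<phi> p = ennreal (indicator D p * (c p + B))" for p
  have "(\<lambda>p. indicator D p *\<^sub>R (c p + B)) \<in> borel_measurable borel"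
    using \<open>closed D\<close> cD by (intro borel_measurable_continuous_on_indicator continuous_intros) auto
  then have \<phi>m: "\<phi> \<in> borel_measurable borel"
    unfolding \<phi>_def by (auto intro: measurable_compose)
  interpret q: prob_space q using q by (simp add: prob_measures_on_def)
  have sq [measurable_cong]: "sets q = sets borel" using q by (simp add: prob_measures_on_def)
  have qX: "AE x in q. x \<in> closure X"
    using q q.AE_prob_1[of "closure X"] by (simp add: prob_measures_on_def measure_def)
  have cost: "integral\<^sup>N \<gamma> \<phi> = ennreal (set_lebesgue_integral \<gamma> D c + B)" "- B \<le> set_lebesgue_integral \<gamma> D c"
    if "\<gamma> \<in> couplings m \<nu>" "m \<in> prob_measures_on (closure X)" for \<gamma> m
    using couplingsD[OF that \<nu>] nn_integral_cost[OF _ _ _ \<open>closed D\<close> cD B] unfolding D_def \<phi>_def by auto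
  have "transport_cost X Y c \<mu>' \<nu> - e \<le> transport_cost X Y c \<mu> \<nu>"
    unfolding transport_cost_def D_def[symmetric]
  proof (rule cINF_greatest)
    show "couplings \<mu> \<nu> \<noteq> {}"
      using pair_measure_in_couplings[of \<mu> \<nu>] \<mu> \<nu> by (auto simp: prob_measures_on_def)
    fix \<gamma> assume \<gamma>: "\<gamma> \<in> couplings \<mu> \<nu>"
    define \<gamma>' where "\<gamma>' = move_mass f q \<gamma>"
    have \<gamma>': "\<gamma>' \<in> couplings \<mu>' \<nu>"
      unfolding \<gamma>'_def using \<mu>'P
      by (intro move_mass_in_couplings[OF \<gamma> sq _ q.prob_space_axioms f f01 \<mu>']) (auto simp: prob_measures_on_def)
    note \<gamma>D = couplingsD[OF \<gamma> \<mu> \<nu>]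
    have m: "fst \<in> measurable \<gamma> (borel :: 'a measure)"
      unfolding measurable_cong_sets[OF \<gamma>D(1) refl]
      by (intro borel_measurable_continuous_onI continuous_on_fst continuous_on_id)
    have nm: "(\<lambda>x'. ennreal (M * (norm x + norm x'))) \<in> borel_measurable q" for x
      unfolding measurable_cong_sets[OF sq refl] by measurable
    have nm2: "(\<lambda>x. \<integral>\<^sup>+x'. ennreal (M * (norm x + norm x')) \<partial>q) \<in> borel_measurable borel"
      by measurable
    have "integral\<^sup>N \<gamma>' \<phi> = (\<integral>\<^sup>+p. \<integral>\<^sup>+x. ennreal (f (fst p)) * \<phi> (x, snd p) + ennreal (1 - f (fst p)) * \<phi> p \<partial>q \<partial>\<gamma>)"
      unfolding \<gamma>'_def by (rule nn_integral_move_mass[OF \<gamma>D(1) sq q.sigma_finite_measure_axioms f \<phi>m])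
    also have "\<dots> \<le> (\<integral>\<^sup>+p. \<integral>\<^sup>+x. \<phi> p + ennreal (f (fst p)) * ennreal (M * (norm (fst p) + norm x)) \<partial>q \<partial>\<gamma>)"
    proof (rule nn_integral_mono_AE, use \<gamma>D(3) in eventually_elim, rule nn_integral_mono_AE, use qX in eventually_elim)
      fix p x assume p: "p \<in> closure X \<times> closure Y" and x: "x \<in> closure X"
      then have xy: "(x, snd p) \<in> D" "p \<in> D" by (auto simp: D_def)
      have "dist (c (x, snd p)) (c (fst p, snd p)) \<le> M * dist x (fst p)"
        using p x by (intro lipschitz_onD[OF lip]) (auto simp: mem_Times_iff)
      also have "\<dots> \<le> M * (norm (fst p) + norm x)"
        using p by (intro mult_left_mono lipschitz_on_nonneg[OF lip]) 
          (auto simp: mem_Times_iff dist_norm norm_minus_commute intro: order_trans[OF norm_triangle_ineq4])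
      finally have 1: "c (x, snd p) \<le> c p + M * (norm (fst p) + norm x)" by (simp add: dist_real_def abs_le_iff)
      have M: "0 \<le> M * (norm (fst p) + norm x)"
        using p by (intro mult_nonneg_nonneg lipschitz_on_nonneg[OF lip]) (auto simp: mem_Times_iff)
      have n: "0 \<le> c (x, snd p) + B" "0 \<le> c p + B" using B[OF xy(1)] B[OF xy(2)] by (simp_all add: abs_le_iff)
      have "f (fst p) * (c (x, snd p) + B) + (1 - f (fst p)) * (c p + B) \<le> (c p + B) + f (fst p) * (M * (norm (fst p) + norm x))"
        using mult_left_mono[OF 1 f01(1)[of "fst p"]] by (simp add: algebra_simps)
      then have "ennreal (f (fst p) * (c (x, snd p) + B) + (1 - f (fst p)) * (c p + B))
        \<le> ennreal ((c p + B) + f (fst p) * (M * (norm (fst p) + norm x)))" by (rule ennreal_leI)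
      then show "ennreal (f (fst p)) * \<phi> (x, snd p) + ennreal (1 - f (fst p)) * \<phi> p
          \<le> \<phi> p + ennreal (f (fst p)) * ennreal (M * (norm (fst p) + norm x))"
        using n M f01[of "fst p"] xy by (simp add: \<phi>_def ennreal_mult)
    qed
    also have "\<dots> = (\<integral>\<^sup>+p. \<phi> p + ennreal (f (fst p)) * (\<integral>\<^sup>+x. ennreal (M * (norm (fst p) + norm x)) \<partial>q) \<partial>\<gamma>)"
      by (intro nn_integral_cong) (simp add: nn_integral_add nn_integral_cmult nm q.emeasure_space_1)
    also have "\<dots> = integral\<^sup>N \<gamma> \<phi> + (\<integral>\<^sup>+p. ennreal (f (fst p)) * (\<integral>\<^sup>+x. ennreal (M * (norm (fst p) + norm x)) \<partial>q) \<partial>\<gamma>)"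
    proof (rule nn_integral_add)
      show "\<phi> \<in> borel_measurable \<gamma>" using \<phi>m measurable_cong_sets[OF \<gamma>D(1) refl] by blast
      show "(\<lambda>p. ennreal (f (fst p)) * (\<integral>\<^sup>+x. ennreal (M * (norm (fst p) + norm x)) \<partial>q)) \<in> borel_measurable \<gamma>"
        by (intro borel_measurable_times_ennreal measurable_compose[OF m nm2] measurable_compose[OF m]) auto
    qed
    also have "(\<integral>\<^sup>+p. ennreal (f (fst p)) * (\<integral>\<^sup>+x. ennreal (M * (norm (fst p) + norm x)) \<partial>q) \<partial>\<gamma>)
       = (\<integral>\<^sup>+z. ennreal (f z) * (\<integral>\<^sup>+x. ennreal (M * (norm z + norm x)) \<partial>q) \<partial>distr \<gamma> borel fst)"
      by (subst nn_integral_distr[OF m]) (auto intro!: borel_measurable_times_ennreal nm2)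
    also have "distr \<gamma> borel fst = \<mu>" using \<gamma> by (simp add: couplings_def)
    also note e(1)
    finally have "integral\<^sup>N \<gamma>' \<phi> \<le> integral\<^sup>N \<gamma> \<phi> + ennreal e" by (simp add: add_left_mono)
    then have le: "set_lebesgue_integral \<gamma>' D c \<le> set_lebesgue_integral \<gamma> D c + e"
      using cost[OF \<gamma> \<mu>] cost[OF \<gamma>' \<mu>'P] e(2) by (simp add: ennreal_plus[symmetric] del: ennreal_plus)
    have "(INF \<gamma>\<in>couplings \<mu>' \<nu>. set_lebesgue_integral \<gamma> D c) \<le> set_lebesgue_integral \<gamma>' D c"
      using cost(2)[OF _ \<mu>'P] by (intro cINF_lower bdd_belowI2[where m = "- B"] \<gamma>') auto
    with le show "(INF \<gamma>\<in>couplings \<mu>' \<nu>. set_lebesgue_integral \<gamma> D c) - e \<le> set_lebesgue_integral \<gamma> D c" by simp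
  qed
  then show ?thesis by simp
qed

section \<open>Density bound for minimizers\<close>

lemma extended_integral_eq_integral:
  assumes "integrable M f"
  shows "extended_integral M f = ereal (integral\<^sup>L M f)"
proof -
  have "(\<integral>\<^sup>+x. ennreal (f x) \<partial>M) < \<infinity>" "(\<integral>\<^sup>+x. ennreal (- f x) \<partial>M) < \<infinity>"
    using assms unfolding real_integrable_def by (auto simp: top.not_eq_extremum)
  then show ?thesis
    unfolding extended_integral_def real_lebesgue_integral_def[OF assms]
    by (cases "\<integral>\<^sup>+x. ennreal (f x) \<partial>M"; cases "\<integral>\<^sup>+x. ennreal (- f x) \<partial>M") auto
qed

text \<open>On a finite measure the lower bound makes the negative part finite, so only the positive
  part could produce the value \<open>\<infinity>\<close>.\<close>

lemma (in finite_measure) integrable_if_extended_integral_finite: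
  assumes "f \<in> borel_measurable M" "\<And>x. - b \<le> f x" "extended_integral M f \<noteq> \<infinity>"
  shows "integrable M f"
proof -
  have "(\<integral>\<^sup>+x. ennreal (- f x) \<partial>M) \<le> (\<integral>\<^sup>+x. ennreal b \<partial>M)"
    using assms(2) by (intro nn_integral_mono ennreal_leI) (simp add: minus_le_iff)
  also have "\<dots> < \<infinity>" using emeasure_finite by (simp add: ennreal_mult_eq_top_iff less_top[symmetric])
  finally have neg: "(\<integral>\<^sup>+x. ennreal (- f x) \<partial>M) \<noteq> \<infinity>" by simp
  moreover have "(\<integral>\<^sup>+x. ennreal (f x) \<partial>M) \<noteq> \<infinity>"
    using assms(3) by (auto simp: extended_integral_def)
  ultimately show ?thesis using assms(1) unfolding real_integrable_def by simp
qed

lemma density_of_density: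
  assumes [measurable]: "u \<in> borel_measurable borel" and "\<And>x. 0 \<le> u x"
  shows "AE x in lborel. density_of (density lborel (\<lambda>x. ennreal (u x))) x = u x"
proof -
  have "AE x in lborel. ennreal (u x) = RN_deriv lborel (density lborel (\<lambda>x. ennreal (u x))) x"
    by (rule sigma_finite_measure.RN_deriv_unique[OF sigma_finite_lborel]) auto
  then show ?thesis
    unfolding density_of_def by eventually_elim (metis assms(2) enn2real_ennreal)
qed

lemma measurable_density_of [measurable]: "density_of \<mu> \<in> borel_measurable borel"
  unfolding density_of_def by measurable

text \<open>\<open>enn2real\<close> sends infinite values to 0; this is harmless because the
  Radon-Nikodym derivative of a finite measure is finite almost everywhere.\<close>

lemma density_density_of:
  fixes \<mu> :: "'a::euclidean_space measure"
  assumes "absolutely_continuous lborel \<mu>" "sets \<mu> = sets borel" "finite_measure \<mu>"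
  shows "\<mu> = density lborel (\<lambda>x. ennreal (density_of \<mu> x))"
proof -
  have "sigma_finite_measure \<mu>" using assms(3) by (rule finite_measure.axioms)
  then have "AE x in lborel. RN_deriv lborel \<mu> x \<noteq> \<infinity>"
    using assms by (intro sigma_finite_measure.RN_deriv_finite[OF sigma_finite_lborel]) auto
  then have "density lborel (RN_deriv lborel \<mu>) = density lborel (\<lambda>x. ennreal (density_of \<mu> x))"
    by (intro density_cong) (auto elim!: eventually_mono simp: density_of_def less_top)
  moreover have "density lborel (RN_deriv lborel \<mu>) = \<mu>"
    using assms by (intro sigma_finite_measure.density_RN_deriv[OF sigma_finite_lborel]) auto
  ultimately show ?thesis by simp
qed

lemma congestion_density:
  fixes u :: "'a::euclidean_space \<Rightarrow> real"
  assumes "open X" and [measurable]: "u \<in> borel_measurable borel" and u: "\<And>x. 0 \<le> u x"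
  shows "congestion X g (density lborel (\<lambda>x. ennreal (u x))) =
    extended_integral (restrict_space lborel X) (\<lambda>x. g (u x))"
proof -
  have "AE x in restrict_space lborel X. density_of (density lborel (\<lambda>x. ennreal (u x))) x = u x"
    using density_of_density[OF assms(2) u] assms(1)
    by (subst AE_restrict_space_iff) (auto elim!: eventually_mono)
  then have "extended_integral (restrict_space lborel X) (\<lambda>x. g (density_of (density lborel (\<lambda>x. ennreal (u x))) x))
    = extended_integral (restrict_space lborel X) (\<lambda>x. g (u x))"
    unfolding extended_integral_def
    by (intro arg_cong2[where f = minus] arg_cong[where f = enn2ereal] nn_integral_cong_AE)
      (auto elim!: eventually_mono)
  then show ?thesis
    using assms(2) by (simp add: congestion_def absolutely_continuousI_density)
qed

context congestion_function
begin

lemma ex_finite_congestion: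
  fixes X :: "'a::euclidean_space set"
  assumes "open X" "bounded X" "X \<noteq> {}"
  shows "\<exists>\<mu>\<in>prob_measures_on (closure X). congestion X g \<mu> \<noteq> \<infinity>"
proof
  define v where "v = measure lborel X"
  \<comment> \<open>The uniform distribution on \<open>X\<close>: its congestion integrand is
    constant on a set of finite measure.\<close>
  define u where "u x = indicator X x / v" for x
  define \<mu> where "\<mu> = density lborel (\<lambda>x. ennreal (u x))"
  have v: "v > 0" "emeasure lborel X = ennreal v"
    unfolding v_def using assms measure_lborel_open_pos emeasure_bounded_finite[of X]
    by (auto simp: emeasure_eq_ennreal_measure)
  interpret L: finite_measure "restrict_space lborel X"
    using assms by (intro finite_measure_restrict_lborel)
  have [measurable]: "X \<in> sets borel" "u \<in> borel_measurable borel" using assms unfolding u_def by auto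
  have e: "emeasure \<mu> A = 1" if "X \<subseteq> A" "A \<in> sets borel" for A
  proof -
    have "emeasure \<mu> A = (\<integral>\<^sup>+x. ennreal (1 / v) * indicator X x \<partial>lborel)"
      using that unfolding \<mu>_def by (subst emeasure_density) (auto intro!: nn_integral_cong simp: u_def indicator_def)
    also have "\<dots> = ennreal (1 / v) * ennreal v" using v(2) by (simp add: nn_integral_cmult_indicator)
    also have "\<dots> = 1" using v(1) by (simp add: ennreal_mult[symmetric])
    finally show ?thesis .
  qed
  have "sets \<mu> = sets borel" "space \<mu> = UNIV" by (simp_all add: \<mu>_def)
  then show "\<mu> \<in> prob_measures_on (closure X)"
    using e[of UNIV] e[of "closure X"] closure_subset by (auto simp: prob_measures_on_def intro: prob_spaceI)
  have "congestion X g \<mu> = extended_integral (restrict_space lborel X) (\<lambda>x. g (u x))"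
    unfolding \<mu>_def using assms v by (intro congestion_density) (auto simp: u_def)
  also have "\<dots> = extended_integral (restrict_space lborel X) (\<lambda>x. g (1 / v))"
    unfolding extended_integral_def
    by (intro arg_cong2[where f = minus] arg_cong[where f = enn2ereal] nn_integral_cong)
      (auto simp: space_restrict_space u_def)
  also have "\<dots> \<noteq> \<infinity>" by (subst extended_integral_eq_integral) auto
  finally show "congestion X g \<mu> \<noteq> \<infinity>" .
qed

text \<open>The transport term is a real number, so infinite congestion would make the total cost
  infinite. By the definition of \<open>congestion\<close>, this also makes every minimizer
  absolutely continuous.\<close>

lemma minimizer_congestion_finite:
  fixes X :: "'a::euclidean_space set"
  assumes "open X" "bounded X" "X \<noteq> {}"
    and min: "is_minimizer_on (prob_measures_on (closure X)) (total_cost X Y c g \<nu>) \<mu>"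
  shows "congestion X g \<mu> \<noteq> \<infinity>"
proof
  assume inf: "congestion X g \<mu> = \<infinity>"
  obtain \<mu>0 where "\<mu>0 \<in> prob_measures_on (closure X)" "congestion X g \<mu>0 \<noteq> \<infinity>"
    using ex_finite_congestion[OF assms(1-3)] by blast
  with min have "total_cost X Y c g \<nu> \<mu> \<le> total_cost X Y c g \<nu> \<mu>0"
    by (simp add: is_minimizer_on_def)
  with inf \<open>congestion X g \<mu>0 \<noteq> \<infinity>\<close> show False
    by (simp add: total_cost_def)
qed

text \<open>If the density exceeded the bound \<open>h\<close> with positive volume, it would lie below the profile
  \<open>l\<close>, of total mass 1, somewhere else. Moving mass from the first region to the second
  costs at most \<open>M * norm x\<close> per unit on either side, while the marginal congestion cost is more than
  \<open>\<kappa> + M * norm x\<close> where mass is removed and at most \<open>\<kappa> - M * norm x\<close> where it is added.\<close>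

lemma minimizer_density_bound:
  fixes X :: "'a::euclidean_space set" and c :: "'a \<times> real \<Rightarrow> real"
  assumes X: "open X" "bounded X" "X \<noteq> {}" and Y: "bounded Y" and M: "M \<ge> 0"
    and c: "continuous_on (closure X \<times> closure Y) c"
    and lip: "\<And>y. y \<in> closure Y \<Longrightarrow> M-lipschitz_on (closure X) (\<lambda>x. c (x, y))"
    and \<nu>: "\<nu> \<in> prob_measures_on (closure Y)"
    and min: "is_minimizer_on (prob_measures_on (closure X)) (total_cost X Y c g \<nu>) \<mu>"
  shows "AE x in lborel. x \<in> X \<longrightarrow>
    density_of \<mu> x \<le> deriv_inverse g (K X g (\<lambda>x. M * norm x) 1 + M * norm x)"
proof (rule ccontr)
  define \<kappa> where "\<kappa> = K X g (\<lambda>x. M * norm x) 1"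
  define h where "h x = deriv_inverse g (\<kappa> + M * norm x)" for x :: 'a
  define l where "l x = deriv_inverse g (\<kappa> - M * norm x)" for x :: 'a
  define u where "u = density_of \<mu>"
  define L where "L = restrict_space lborel X"
  assume "\<not> ?thesis"
  then have notAE: "\<not> (AE x in lborel. x \<in> X \<longrightarrow> u x \<le> h x)" by (simp add: u_def h_def \<kappa>_def)

  have \<mu>P: "\<mu> \<in> prob_measures_on (closure X)" using min by (simp add: is_minimizer_on_def)
  then interpret \<mu>: prob_space \<mu> by (simp add: prob_measures_on_def)
  interpret L: finite_measure L
    unfolding L_def using X(1,2) by (intro finite_measure_restrict_lborel)
  have XB [measurable]: "X \<in> sets borel" using X(1) by simp
  have spL: "space L = X" by (simp add: L_def space_restrict_space)
  have mL: "w \<in> borel_measurable L" if "w \<in> borel_measurable borel" for w :: "'a \<Rightarrow> real"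
    using that unfolding L_def by (intro measurable_restrict_space1) simp
  have L_iff: "integrable L w \<longleftrightarrow> integrable lborel w" "integral\<^sup>L L w = integral\<^sup>L lborel w"
    if "\<And>x. x \<notin> X \<Longrightarrow> w x = 0" for w :: "'a \<Rightarrow> real"
  proof -
    have "(\<lambda>x. indicator X x *\<^sub>R w x) = w" using that by (auto simp: indicator_def fun_eq_iff)
    then show "integrable L w \<longleftrightarrow> integrable lborel w" "integral\<^sup>L L w = integral\<^sup>L lborel w"
      unfolding L_def by (simp_all add: integrable_restrict_space integral_restrict_space del: real_scaleR_def)
  qed

  have fin: "congestion X g \<mu> \<noteq> \<infinity>" by (rule minimizer_congestion_finite[OF X min])
  then have "absolutely_continuous lborel \<mu>" unfolding congestion_def by (metis)
  then have \<mu>u: "\<mu> = density lborel (\<lambda>x. ennreal (u x))"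
    unfolding u_def using \<mu>P \<mu>.finite_measure_axioms by (intro density_density_of) (auto simp: prob_measures_on_def)
  have [measurable]: "u \<in> borel_measurable borel" by (simp add: u_def)
  have u0: "0 \<le> u x" for x by (simp add: u_def density_of_def)
  have hl: "0 < l x" "l x \<le> h x" for x
    using M strict_mono_leD[OF deriv_inverse_strict_mono, of "\<kappa> - M * norm x" "\<kappa> + M * norm x"]
    by (simp_all add: l_def h_def deriv_inverse_pos)
  have [measurable]: "h \<in> borel_measurable borel" "l \<in> borel_measurable borel"
    unfolding h_def l_def by measurable
  have l_int: "integrable L l" and l1: "integral\<^sup>L L l = 1"
    using level_integrable[OF X(1,2), of \<kappa> "- M"] K_eq[OF X M] by (simp_all add: l_def[abs_def] L_def \<kappa>_def[symmetric])
  have u_nn: "(\<integral>\<^sup>+x. ennreal (u x) \<partial>lborel) = 1"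
  proof -
    have "emeasure \<mu> UNIV = (\<integral>\<^sup>+x. ennreal (u x) \<partial>lborel)"
      by (subst \<mu>u, subst emeasure_density) auto
    moreover have "space \<mu> = UNIV" by (subst \<mu>u) simp
    ultimately show ?thesis using \<mu>.emeasure_space_1 by simp
  qed
  then have u_int: "integrable lborel u" "integral\<^sup>L lborel u = 1"
    using u0 by (auto simp: integrable_iff_bounded integral_eq_nn_integral)
  have uX_int: "integrable lborel (\<lambda>x. indicator X x * u x)"
    using integrable_mult_indicator[OF _ u_int(1), of X] by simp
  \<comment> \<open>Only an inequality is available: \<open>\<mu>\<close> is a measure on
    \<open>closure X\<close> and may charge a boundary of positive volume.\<close>
  have uL_int: "integrable L u" "integral\<^sup>L L u \<le> 1"
  proof -
    show "integrable L u" using uX_int by (simp add: L_def integrable_restrict_space)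
    have "integral\<^sup>L L u = (\<integral>x. indicator X x * u x \<partial>lborel)" by (simp add: L_def integral_restrict_space)
    also have "\<dots> \<le> integral\<^sup>L lborel u"
      using u0 by (intro integral_mono uX_int u_int) (auto simp: indicator_def)
    finally show "integral\<^sup>L L u \<le> 1" using u_int by simp
  qed

  \<comment> \<open>Excess, deficit and the competitor\<close>
  define a where "a x = indicator X x * max 0 (u x - h x)" for x
  define b where "b x = indicator X x * max 0 (l x - u x)" for x
  have [measurable]: "a \<in> borel_measurable borel" "b \<in> borel_measurable borel" unfolding a_def b_def by measurable
  have ab0: "0 \<le> a x" "0 \<le> b x" "a x \<le> u x" for x
    using u0[of x] hl[of x] by (auto simp: a_def b_def indicator_def)
  have abX: "a x = 0" "b x = 0" if "x \<notin> X" for x using that by (simp_all add: a_def b_def)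
  have a_int: "integrable lborel a"
    by (rule Bochner_Integration.integrable_bound[OF u_int(1)]) (use ab0 u0 in auto)
  have b_int: "integrable lborel b"
  proof -
    have "integrable L b"
      by (rule Bochner_Integration.integrable_bound[OF l_int])
        (use ab0 u0 hl in \<open>auto intro!: mL simp: spL b_def less_imp_le indicator_def\<close>)
    then show ?thesis using L_iff(1)[of b] abX by simp
  qed
  define \<alpha> where "\<alpha> = integral\<^sup>L lborel a"
  define \<beta> where "\<beta> = integral\<^sup>L lborel b"
  have aL: "integrable L a" "integral\<^sup>L L a = \<alpha>" and bL: "integrable L b" "integral\<^sup>L L b = \<beta>"
    using L_iff[of a] L_iff[of b] abX a_int b_int by (simp_all add: \<alpha>_def \<beta>_def)
  have \<alpha>: "\<alpha> > 0"
  proof -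
    have "\<alpha> \<ge> 0" using ab0 by (simp add: \<alpha>_def)
    moreover have "\<alpha> \<noteq> 0"
    proof
      assume "\<alpha> = 0"
      then have "AE x in lborel. a x = 0"
        using integral_nonneg_eq_0_iff_AE[OF a_int] ab0 by (simp add: \<alpha>_def)
      then have "AE x in lborel. x \<in> X \<longrightarrow> u x \<le> h x"
        by eventually_elim (auto simp: a_def max_def split: if_splits)
      with notAE show False by simp
    qed
    ultimately show ?thesis by simp
  qed
  \<comment> \<open>As \<open>l x \<le> h x\<close>, excess and deficit never occur at the same
    point, which gives \<open>l - u + a \<le> b\<close> on \<open>X\<close>. Integrating, with mass
    1 for \<open>l\<close> and at most 1 for \<open>u\<close>, yields the claim.\<close>
  have \<beta>: "\<alpha> \<le> \<beta>"
  proof -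
    have "l x - u x + a x \<le> b x" if "x \<in> X" for x
      using hl(2)[of x] that by (simp add: a_def b_def max_def)
    then have "integral\<^sup>L L (\<lambda>x. l x - u x + a x) \<le> integral\<^sup>L L b"
      by (intro integral_mono bL aL uL_int l_int Bochner_Integration.integrable_add Bochner_Integration.integrable_diff)
        (simp add: spL)
    then show ?thesis using uL_int l1 l_int aL bL by simp
  qed
  \<comment> \<open>Half of the excess is removed, so the density stays strictly above
    \<open>h\<close> where it was above. The factor \<open>t\<close> makes the added mass
    \<open>t * \<beta>\<close> equal to the removed mass \<open>\<alpha> / 2\<close>, and
    \<open>t < 1\<close> prevents the density from rising above \<open>l\<close> where it was
    below.\<close>
  define t where "t = \<alpha> / (2 * \<beta>)"
  have t: "0 < t" "t < 1" "t * \<beta> = \<alpha> / 2" using \<alpha> \<beta> by (simp_all add: t_def field_simps)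
  define q where "q = density lborel (\<lambda>x. ennreal (b x / \<beta>))"
  \<comment> \<open>The fraction of the mass at \<open>x\<close> that leaves. Where
    \<open>u x = 0\<close> also \<open>a x = 0\<close>, and division by zero gives the right value
    0.\<close>
  define f where "f x = a x / (2 * u x)" for x
  define u' where "u' x = u x - a x / 2 + t * b x" for x
  define \<mu>' where "\<mu>' = density lborel (\<lambda>x. ennreal (u' x))"
  have [measurable]: "f \<in> borel_measurable borel" "u' \<in> borel_measurable borel"
    unfolding f_def u'_def by measurable
  have f01: "0 \<le> f x" "f x \<le> 1" for x
    using ab0[of x] u0[of x] by (auto simp: f_def divide_le_eq_1)
  have uf: "u x * f x = a x / 2" for x using ab0[of x] by (cases "u x = 0") (auto simp: f_def)
  have u'0: "0 \<le> u' x" for x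
    using ab0[of x] t(1) u0[of x] unfolding u'_def by (intro add_nonneg_nonneg mult_nonneg_nonneg) auto
  have q: "q \<in> prob_measures_on (closure X)"
  proof -
    have "emeasure q A = 1" if "X \<subseteq> A" and [measurable]: "A \<in> sets borel" for A
    proof -
      have b0: "b x = 0" if "x \<notin> A" for x using abX(2)[of x] \<open>X \<subseteq> A\<close> that by blast
      have "emeasure q A = (\<integral>\<^sup>+x. ennreal (b x / \<beta>) \<partial>lborel)"
        using b0 unfolding q_def by (subst emeasure_density) (auto intro!: nn_integral_cong simp: indicator_def)
      also have "\<dots> = ennreal (\<integral>x. b x / \<beta> \<partial>lborel)"
        using \<alpha> \<beta> ab0 b_int by (intro nn_integral_eq_integral) auto
      also have "\<dots> = 1" using \<alpha> \<beta> by (simp add: \<beta>_def[symmetric])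
      finally show ?thesis .
    qed
    from this[of UNIV] this[of "closure X"] show ?thesis
      using closure_subset by (auto simp: prob_measures_on_def q_def intro!: prob_spaceI)
  qed
  have \<mu>': "emeasure \<mu>' A = (\<integral>\<^sup>+x. ennreal (f x) * emeasure q A + ennreal (1 - f x) * indicator A x \<partial>\<mu>)"
    if [measurable]: "A \<in> sets borel" for A
  proof -
    have "(\<integral>\<^sup>+x. ennreal (f x) * emeasure q A + ennreal (1 - f x) * indicator A x \<partial>\<mu>)
      = (\<integral>\<^sup>+x. ennreal (u x) * (ennreal (f x) * emeasure q A + ennreal (1 - f x) * indicator A x) \<partial>lborel)"
      by (subst \<mu>u, subst nn_integral_density) auto
    also have "\<dots> = (\<integral>\<^sup>+x. ennreal (a x / 2) * emeasure q A + ennreal (u x - a x / 2) * indicator A x \<partial>lborel)"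
    proof (rule nn_integral_cong)
      fix x
      have "u x * (1 - f x) = u x - a x / 2" using uf[of x] by (simp add: algebra_simps)
      then have "ennreal (u x) * ennreal (f x) = ennreal (a x / 2)"
        "ennreal (u x) * ennreal (1 - f x) = ennreal (u x - a x / 2)"
        using f01[of x] u0[of x] uf[of x] by (simp_all only: ennreal_mult[symmetric] diff_ge_0_iff_ge)
      then show "ennreal (u x) * (ennreal (f x) * emeasure q A + ennreal (1 - f x) * indicator A x)
        = ennreal (a x / 2) * emeasure q A + ennreal (u x - a x / 2) * indicator A x"
        by (simp only: distrib_left mult.assoc[symmetric])
    qed
    also have "\<dots> = (\<integral>\<^sup>+x. ennreal (a x / 2) \<partial>lborel) * emeasure q A + (\<integral>\<^sup>+x. ennreal (u x - a x / 2) * indicator A x \<partial>lborel)"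
      by (simp add: nn_integral_add nn_integral_multc)
    also have "(\<integral>\<^sup>+x. ennreal (a x / 2) \<partial>lborel) = ennreal (\<alpha> / 2)"
      using a_int ab0 by (subst nn_integral_eq_integral) (auto simp: \<alpha>_def)
    also have "ennreal (\<alpha> / 2) * emeasure q A = (\<integral>\<^sup>+x. ennreal (\<alpha> / 2) * (ennreal (b x / \<beta>) * indicator A x) \<partial>lborel)"
      unfolding q_def by (subst emeasure_density) (auto simp: nn_integral_cmult)
    also have "\<dots> + (\<integral>\<^sup>+x. ennreal (u x - a x / 2) * indicator A x \<partial>lborel)
      = (\<integral>\<^sup>+x. ennreal (\<alpha> / 2) * (ennreal (b x / \<beta>) * indicator A x) + ennreal (u x - a x / 2) * indicator A x \<partial>lborel)"
      by (subst nn_integral_add) auto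
    also have "\<dots> = (\<integral>\<^sup>+x. ennreal (u' x) * indicator A x \<partial>lborel)"
    proof (rule nn_integral_cong)
      fix x
      have "u' x = \<alpha> / 2 * (b x / \<beta>) + (u x - a x / 2)" by (simp add: u'_def t_def)
      moreover have "0 \<le> u x - a x / 2" using ab0[of x] by simp
      ultimately show "ennreal (\<alpha> / 2) * (ennreal (b x / \<beta>) * indicator A x) + ennreal (u x - a x / 2) * indicator A x
        = ennreal (u' x) * indicator A x"
        using \<alpha> \<beta> ab0[of x] by (simp add: ennreal_plus ennreal_mult distrib_right mult.assoc del: times_divide_eq_right times_divide_eq_left times_divide_times_eq)
    qed
    also have "\<dots> = emeasure \<mu>' A" unfolding \<mu>'_def by (subst emeasure_density) auto
    finally show ?thesis by simp
  qed
  have s': "sets \<mu>' = sets borel" by (simp add: \<mu>'_def)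
  have \<mu>'P: "\<mu>' \<in> prob_measures_on (closure X)"
    by (rule move_mass_in_prob_measures_on[OF _ \<mu>P q s' f01 \<mu>']) simp

  \<comment> \<open>Transport cost of the competitor\<close>
  obtain R where R: "\<And>x. x \<in> X \<Longrightarrow> norm x \<le> R"
    using X(2) unfolding bounded_iff by blast
  have norm_int: "integrable lborel (\<lambda>x. norm x * w x)"
    if w: "integrable lborel w" "\<And>x. x \<notin> X \<Longrightarrow> w x = 0" for w :: "'a \<Rightarrow> real"
  proof (rule Bochner_Integration.integrable_bound)
    show "integrable lborel (\<lambda>x. R * w x)" using w by simp
    show "(\<lambda>x. norm x * w x) \<in> borel_measurable lborel" using w(1) by measurable
    show "AE x in lborel. norm (norm x * w x) \<le> norm (R * w x)"
    proof (rule AE_I2)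
      fix x show "norm (norm x * w x) \<le> norm (R * w x)"
        using R[of x] w(2)[of x] by (cases "x \<in> X") (auto simp: abs_mult intro!: mult_right_mono)
    qed
  qed
  define I where "I = (\<integral>x. norm x * a x \<partial>lborel)"
  define J where "J = (\<integral>x. norm x * b x \<partial>lborel)"
  have IJ0: "I \<ge> 0" "J \<ge> 0" using ab0 by (simp_all add: I_def J_def)
  note aI = norm_int[OF a_int abX(1)] and bI = norm_int[OF b_int abX(2)]
  \<comment> \<open>Removed mass has density \<open>a / 2\<close>, added mass \<open>t * b\<close>;
    each unit is charged \<open>M * norm x\<close> at its own location.\<close>
  define e where "e = M * I / 2 + t * M * J"
  have "e \<ge> 0" using M IJ0 t by (simp add: e_def)
  have inner: "(\<integral>\<^sup>+x'. ennreal (M * (norm x + norm x')) \<partial>q) = ennreal (M * norm x + M * J / \<beta>)" for x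
  proof -
    have "(\<integral>\<^sup>+x'. ennreal (M * (norm x + norm x')) \<partial>q) = (\<integral>\<^sup>+x'. ennreal (b x' / \<beta>) * ennreal (M * (norm x + norm x')) \<partial>lborel)"
      unfolding q_def by (subst nn_integral_density) auto
    also have "\<dots> = (\<integral>\<^sup>+x'. ennreal (M * norm x / \<beta> * b x' + M / \<beta> * (norm x' * b x')) \<partial>lborel)"
    proof (rule nn_integral_cong)
      fix x'
      have "ennreal (b x' / \<beta>) * ennreal (M * (norm x + norm x')) = ennreal (b x' / \<beta> * (M * (norm x + norm x')))"
        using ab0 \<alpha> \<beta> M by (simp only: ennreal_mult divide_nonneg_pos mult_nonneg_nonneg add_nonneg_nonneg norm_ge_zero)
      also have "b x' / \<beta> * (M * (norm x + norm x')) = M * norm x / \<beta> * b x' + M / \<beta> * (norm x' * b x')"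
        by (simp add: algebra_simps add_divide_distrib)
      finally show "ennreal (b x' / \<beta>) * ennreal (M * (norm x + norm x'))
        = ennreal (M * norm x / \<beta> * b x' + M / \<beta> * (norm x' * b x'))" .
    qed
    also have "\<dots> = ennreal (\<integral>x'. M * norm x / \<beta> * b x' + M / \<beta> * (norm x' * b x') \<partial>lborel)"
      using ab0 \<alpha> \<beta> M b_int bI by (intro nn_integral_eq_integral) auto
    also have "(\<integral>x'. M * norm x / \<beta> * b x' + M / \<beta> * (norm x' * b x') \<partial>lborel) = M * norm x + M * J / \<beta>"
      using b_int bI \<alpha> \<beta> by (simp add: \<beta>_def[symmetric] J_def[symmetric])
    finally show ?thesis .
  qed
  have "(\<integral>\<^sup>+x. ennreal (f x) * (\<integral>\<^sup>+x'. ennreal (M * (norm x + norm x')) \<partial>q) \<partial>\<mu>)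
    = (\<integral>\<^sup>+x. ennreal (u x) * (ennreal (f x) * ennreal (M * norm x + M * J / \<beta>)) \<partial>lborel)"
    unfolding inner by (subst \<mu>u, subst nn_integral_density) auto
  also have "\<dots> = (\<integral>\<^sup>+x. ennreal (M / 2 * (norm x * a x) + M * J / (2 * \<beta>) * a x) \<partial>lborel)"
  proof (rule nn_integral_cong)
    fix x :: 'a
    have "0 \<le> M * norm x + M * J / \<beta>" using M IJ0 \<alpha> \<beta> by simp
    then have "ennreal (u x) * (ennreal (f x) * ennreal (M * norm x + M * J / \<beta>)) = ennreal (u x * f x * (M * norm x + M * J / \<beta>))"
      using u0[of x] f01[of x] by (simp add: ennreal_mult mult.assoc)
    also have "u x * f x * (M * norm x + M * J / \<beta>) = M / 2 * (norm x * a x) + M * J / (2 * \<beta>) * a x"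
      using \<alpha> \<beta> unfolding uf by (simp add: field_simps)
    finally show "ennreal (u x) * (ennreal (f x) * ennreal (M * norm x + M * J / \<beta>))
      = ennreal (M / 2 * (norm x * a x) + M * J / (2 * \<beta>) * a x)" .
  qed
  also have "\<dots> = ennreal (\<integral>x. M / 2 * (norm x * a x) + M * J / (2 * \<beta>) * a x \<partial>lborel)"
    using ab0 \<alpha> \<beta> M IJ0 a_int aI by (intro nn_integral_eq_integral) auto
  also have "(\<integral>x. M / 2 * (norm x * a x) + M * J / (2 * \<beta>) * a x \<partial>lborel) = e"
    using a_int aI by (simp add: \<alpha>_def[symmetric] I_def[symmetric] e_def t_def)
  finally have transport: "transport_cost X Y c \<mu>' \<nu> \<le> transport_cost X Y c \<mu> \<nu> + e"
    using \<open>e \<ge> 0\<close>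
    by (intro transport_cost_move_mass[OF X(2) Y c lip \<mu>P \<nu> q s' _ f01 \<mu>']) auto

  \<comment> \<open>Congestion of the competitor\<close>
  define r where "r x = - ((\<kappa> + M * norm x) * (a x / 2)) + (\<kappa> - M * norm x) * (t * b x)" for x
  have r_eq: "r = (\<lambda>x. - (\<kappa> / 2) * a x - M / 2 * (norm x * a x) + \<kappa> * t * b x - M * t * (norm x * b x))"
    by (simp add: r_def fun_eq_iff algebra_simps)
  \<comment> \<open>\<open>r\<close> prices removed mass at \<open>\<kappa> + M * norm x\<close> and
    added mass at \<open>\<kappa> - M * norm x\<close>. The terms with \<open>\<kappa>\<close>
    cancel by \<open>t * \<beta> = \<alpha> / 2\<close>, leaving exactly minus the transport bound
    \<open>e\<close>.\<close>
  have r_int: "integrable L r" and r_integral: "integral\<^sup>L L r = - e"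
  proof -
    have r_lborel: "integrable lborel r" unfolding r_eq using a_int b_int aI bI by auto
    have "integral\<^sup>L lborel r = - (\<kappa> / 2) * \<alpha> - M / 2 * I + \<kappa> * t * \<beta> - M * t * J"
      unfolding r_eq using a_int b_int aI bI by (simp add: \<alpha>_def \<beta>_def I_def J_def)
    also have "\<dots> = - e" using t(3) by (simp add: e_def algebra_simps)
    finally show "integral\<^sup>L L r = - e" using L_iff(2)[of r] abX by (simp add: r_def)
    show "integrable L r" using L_iff(1)[of r] r_lborel abX by (simp add: r_def)
  qed
  \<comment> \<open>Tangents are drawn at \<open>u' x\<close>, which is positive wherever it differs
    from \<open>u x\<close>. Its position relative to \<open>h x\<close> and \<open>l x\<close>
    compares \<open>deriv g (u' x)\<close> with the two prices in \<open>r\<close>.\<close>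
  have g_le: "g (u' x) \<le> g (u x) + r x" and g_less: "h x < u x \<Longrightarrow> g (u' x) < g (u x) + r x" if x: "x \<in> X" for x
  proof -
    have less: "g (u' x) < g (u x) + r x" if hu: "h x < u x"
    proof -
      have ab: "a x = u x - h x" "b x = 0" using hu hl[of x] x by (simp_all add: a_def b_def)
      have "h x < u' x" using hu by (simp add: u'_def ab field_simps)
      have "\<kappa> + M * norm x = deriv g (h x)" by (simp add: h_def deriv_deriv_inverse)
      also have "\<dots> < deriv g (u' x)" using \<open>h x < u' x\<close> hl[of x] by (intro deriv_strict_mono) auto
      finally have "(\<kappa> + M * norm x) * (a x / 2) < deriv g (u' x) * (a x / 2)"
        using hu by (intro mult_strict_right_mono) (auto simp: ab)
      moreover have "g (u' x) + deriv g (u' x) * (u x - u' x) \<le> g (u x)"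
        using \<open>h x < u' x\<close> hl[of x] u0 by (intro above_tangent) auto
      moreover have "u x - u' x = a x / 2" by (simp add: u'_def ab)
      ultimately show ?thesis by (simp add: r_def ab)
    qed
    then show "h x < u x \<Longrightarrow> g (u' x) < g (u x) + r x" .
    consider "h x < u x" | "u x < l x" | "l x \<le> u x" "u x \<le> h x" by linarith
    then show "g (u' x) \<le> g (u x) + r x"
    proof cases
      case 1
      with less show ?thesis by simp
    next
      case 2
      then have ab: "a x = 0" "b x = l x - u x" using hl[of x] x by (simp_all add: a_def b_def)
      have "t * b x > 0" using t 2 by (simp add: ab)
      then have u'pos: "u' x > 0" using u0[of x] by (simp add: u'_def ab(1))
      have "t * b x \<le> b x" using t 2 by (simp add: ab mult_left_le_one_le)
      then have "u' x \<le> l x" by (simp add: u'_def ab)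
      then have "deriv g (u' x) \<le> deriv g (l x)"
        using deriv_strict_mono[OF u'pos, of "l x"] by (cases "u' x = l x") auto
      also have "\<dots> = \<kappa> - M * norm x" by (simp add: l_def deriv_deriv_inverse)
      finally have "deriv g (u' x) * (t * b x) \<le> (\<kappa> - M * norm x) * (t * b x)"
        using \<open>t * b x > 0\<close> by (intro mult_right_mono) auto
      moreover have "g (u' x) + deriv g (u' x) * (u x - u' x) \<le> g (u x)"
        using u'pos u0 by (intro above_tangent) auto
      moreover have "u x - u' x = - (t * b x)" by (simp add: u'_def ab(1))
      ultimately show ?thesis by (simp add: r_def ab(1))
    next
      case 3
      then have "a x = 0" "b x = 0" by (simp_all add: a_def b_def)
      then show ?thesis by (simp add: r_def u'_def)
    qed
  qed
  have \<mu>_cong: "congestion X g \<mu> = extended_integral L (\<lambda>x. g (u x))"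
    using congestion_density[OF X(1) _ u0, where g = g] unfolding L_def by (subst \<mu>u) auto
  obtain B where B: "\<And>s. s \<ge> 0 \<Longrightarrow> - B \<le> g s" using bounded_below by blast
  have mg: "(\<lambda>x. g (u x)) \<in> borel_measurable L" "(\<lambda>x. g (u' x)) \<in> borel_measurable L"
    by (intro mL measurable_comp_nonneg u0 u'0; measurable)+
  have gu: "integrable L (\<lambda>x. g (u x))"
    using fin \<mu>_cong B u0 by (intro L.integrable_if_extended_integral_finite[where b = B] mg) auto
  \<comment> \<open>The new integrand lies between the constant \<open>- B\<close> and the
    integrable function \<open>g (u x) + r x\<close>.\<close>
  have gu': "integrable L (\<lambda>x. g (u' x))"
  proof (rule Bochner_Integration.integrable_bound)
    show "integrable L (\<lambda>x. \<bar>g (u x) + r x\<bar> + \<bar>B\<bar>)" using gu r_int by auto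
    show "AE x in L. norm (g (u' x)) \<le> norm (\<bar>g (u x) + r x\<bar> + \<bar>B\<bar>)"
    proof (rule AE_I2)
      fix x assume "x \<in> space L"
      then have "x \<in> X" by (simp add: spL)
      from g_le[OF this] B[OF u'0[of x]] show "norm (g (u' x)) \<le> norm (\<bar>g (u x) + r x\<bar> + \<bar>B\<bar>)" by simp
    qed
  qed (rule mg)
  have "integral\<^sup>L L (\<lambda>x. g (u' x)) < integral\<^sup>L L (\<lambda>x. g (u x)) - e"
  proof -
    \<comment> \<open>The pointwise inequality is strict only on \<open>P\<close>; the negated claim
      says precisely that this set has positive measure, so the integrals differ strictly.\<close>
    define P where "P = {x \<in> X. h x < u x}"
    have [measurable]: "P \<in> sets borel" unfolding P_def by measurable
    have "emeasure lborel P \<noteq> 0"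
    proof
      assume "emeasure lborel P = 0"
      then have "AE x in lborel. x \<notin> P" by (intro AE_not_in null_setsI) auto
      then have "AE x in lborel. x \<in> X \<longrightarrow> u x \<le> h x" by eventually_elim (auto simp: P_def)
      with notAE show False ..
    qed
    moreover have "emeasure L P = emeasure lborel P"
      unfolding L_def by (rule emeasure_restrict_space) (auto simp: P_def)
    ultimately have "integral\<^sup>L L (\<lambda>x. g (u' x)) < integral\<^sup>L L (\<lambda>x. g (u x) + r x)"
      using g_le g_less
      by (intro L.integral_less_AE[where A = P] gu' AE_I2 Bochner_Integration.integrable_add gu r_int)
        (auto simp: spL P_def L_def sets_restrict_space_iff less_imp_neq)
    then show ?thesis using gu r_int r_integral by simp
  qed
  moreover have "congestion X g \<mu> = ereal (integral\<^sup>L L (\<lambda>x. g (u x)))"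
    using \<mu>_cong extended_integral_eq_integral[OF gu] by simp
  moreover have "congestion X g \<mu>' = ereal (integral\<^sup>L L (\<lambda>x. g (u' x)))"
    using congestion_density[OF X(1) _ u'0, where g = g] extended_integral_eq_integral[OF gu'] unfolding L_def \<mu>'_def by simp
  ultimately have "total_cost X Y c g \<nu> \<mu>' < total_cost X Y c g \<nu> \<mu>"
    using transport by (simp add: total_cost_def)
  with min \<mu>'P show False by (auto simp: is_minimizer_on_def not_le)
qed

end

section \<open>Nestedness\<close>

text \<open>The chain rule identifies \<open>D_y c x y\<close> with the continuous derivative of
  \<open>c\<close> at \<open>(x, y)\<close> applied to \<open>(0, 1)\<close>. This is what makes the
  super-level sets Borel.\<close>

lemma D_y_continuous_on:
  fixes c :: "'a::euclidean_space \<times> real \<Rightarrow> real"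
  assumes "C2_closure (X \<times> Y) c" "y \<in> Y"
  shows "continuous_on X (\<lambda>x. D_y c x y)"
proof -
  obtain D1 D2 where D: "C2_derivatives (X \<times> Y) c D1 D2"
    using assms(1) by (auto simp: C2_closure_def)
  have cont: "continuous_on (X \<times> Y) D1"
    using D unfolding C2_derivatives_def by (blast intro: continuous_on_subset[OF _ closure_subset])
  have eq: "D_y c x y = blinfun_apply (D1 (x, y)) (0, 1)" if "x \<in> X" for x
  proof -
    have "(c has_derivative blinfun_apply (D1 (x, y))) (at (x, y))"
      using D that assms(2) by (auto simp: C2_derivatives_def)
    moreover have "((\<lambda>y'. (x, y')) has_derivative (\<lambda>v. (0, v))) (at y)"
      by (auto intro!: derivative_eq_intros)
    ultimately have "((\<lambda>y'. c (x, y')) has_derivative (\<lambda>v. blinfun_apply (D1 (x, y)) (0, v))) (at y)"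
      by (rule has_derivative_compose[rotated])
    moreover have "(\<lambda>v. blinfun_apply (D1 (x, y)) (0, v)) = (*) (blinfun_apply (D1 (x, y)) (0, 1))"
    proof
      fix v :: real
      show "blinfun_apply (D1 (x, y)) (0, v) = blinfun_apply (D1 (x, y)) (0, 1) * v"
        using blinfun.scaleR_right[of "D1 (x, y)" v "(0, 1)"] by (simp add: mult.commute)
    qed
    ultimately have "((\<lambda>y'. c (x, y')) has_field_derivative blinfun_apply (D1 (x, y)) (0, 1)) (at y)"
      unfolding has_field_derivative_def by (simp only:)
    then show ?thesis unfolding D_y_def by (rule DERIV_imp_deriv)
  qed
  have "continuous_on X (\<lambda>x. D1 (x, y))"
    by (rule continuous_on_compose2[OF cont]) (use assms(2) in \<open>auto intro!: continuous_intros\<close>)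
  then have "continuous_on X (\<lambda>x. blinfun_apply (D1 (x, y)) (0, 1))"
    by (intro continuous_intros)
  then show ?thesis using eq by (simp cong: continuous_on_cong)
qed

lemma X_ge_borel:
  fixes c :: "'a::euclidean_space \<times> real \<Rightarrow> real"
  assumes "open X" "C2_closure (X \<times> Y) c" "y \<in> Y"
  shows "X_ge X c y k \<in> sets borel"
proof -
  have [measurable]: "(\<lambda>x. indicator X x *\<^sub>R D_y c x y) \<in> borel_measurable borel" "X \<in> sets borel"
    using D_y_continuous_on[OF assms(2,3)] assms(1)
    by (simp_all add: borel_measurable_continuous_on_indicator del: real_scaleR_def)
  have "X_ge X c y k = X \<inter> {x \<in> space borel. k \<le> ereal (indicator X x *\<^sub>R D_y c x y)}"
    by (auto simp: X_ge_def)
  also have "\<dots> \<in> sets borel" by measurable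
  finally show ?thesis .
qed

lemma X_ge_subset_k_max:
  "X_ge X c y0 (ereal k0) \<subseteq> X_ge X c y1 (k_max X c y0 y1 k0)"
  unfolding k_max_def by (auto simp: X_ge_def intro!: SUP_least)

text \<open>Averaging the pointwise bound on \<open>h\<close> first over \<open>S\<close> and then over \<open>y\<close>.\<close>

lemma mass_less_of_density_bound:
  fixes S :: "'a::euclidean_space set" and h :: "'a \<Rightarrow> real"
  assumes S: "S \<in> sets borel" "bounded S" "measure lborel S \<noteq> 0" and y: "y0 < y1"
    and h: "h \<in> borel_measurable borel" "\<And>x. 0 \<le> h x"
    and \<nu>: "integrable lborel \<nu>bar" "\<And>y. 0 \<le> \<nu>bar y"
    and less: "\<And>x y. x \<in> S \<Longrightarrow> y0 < y \<Longrightarrow> y < y1 \<Longrightarrow> h x < \<nu>bar y * (y1 - y0) / measure lborel S"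
  shows "(\<integral>\<^sup>+x\<in>S. ennreal (h x) \<partial>lborel) < (\<integral>\<^sup>+y\<in>{y0<..<y1}. ennreal (\<nu>bar y) \<partial>lborel)"
proof -
  define D where "D = measure lborel S"
  have D: "D > 0" using S(3) by (simp add: D_def zero_less_measure_iff)
  have eS: "emeasure lborel S = ennreal D"
    using S emeasure_bounded_finite[of S] by (simp add: D_def emeasure_eq_ennreal_measure)
  let ?S = "restrict_space lborel S" and ?I = "restrict_space lborel {y0<..<y1}"
  interpret S: finite_measure ?S
    using eS S(1) by (intro finite_measureI) (simp add: emeasure_restrict_space space_restrict_space)
  interpret I: finite_measure ?I
    using y by (intro finite_measureI) (simp add: emeasure_restrict_space space_restrict_space)
  have mS: "measure ?S S = D" using S(1) by (simp add: D_def measure_restrict_space)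
  have sp: "space ?S = S" "space ?I = {y0<..<y1}" by (simp_all add: space_restrict_space)
  have hm: "h \<in> borel_measurable ?S" using h(1) by (intro measurable_restrict_space1) simp
  have h_int: "integrable ?S h"
  proof -
    \<comment> \<open>Any single \<open>y\<close> of the interval turns the hypothesis into a
      constant bound for \<open>h\<close> on \<open>S\<close>; the midpoint is one.\<close>
    let ?y = "(y0 + y1) / 2"
    show ?thesis
      using less[of _ ?y] y h(2)
      by (intro S.integrable_const_bound[where B = "\<nu>bar ?y * (y1 - y0) / D"] AE_I2 hm)
        (auto simp: sp D_def less_imp_le)
  qed
  define m where "m = integral\<^sup>L ?S h"
  have m_less: "m / (y1 - y0) < \<nu>bar y" if "y \<in> {y0<..<y1}" for y
  proof -
    have "m < integral\<^sup>L ?S (\<lambda>x. \<nu>bar y * (y1 - y0) / D)"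
      unfolding m_def
      using less that eS D S(1)
      by (intro S.integral_less_AE_space h_int AE_I2) (auto simp: sp D_def emeasure_restrict_space)
    also have "\<dots> = \<nu>bar y * (y1 - y0)" using D by (simp add: sp mS)
    finally show ?thesis using y by (simp add: field_simps)
  qed
  have \<nu>_int: "integrable ?I \<nu>bar"
    using integrable_mult_indicator[OF _ \<nu>(1), of "{y0<..<y1}"] by (simp add: integrable_restrict_space)
  have "integral\<^sup>L ?I (\<lambda>y. m / (y1 - y0)) < integral\<^sup>L ?I \<nu>bar"
    using m_less y
    by (intro I.integral_less_AE_space \<nu>_int AE_I2) (auto simp: sp emeasure_restrict_space)
  moreover have "integral\<^sup>L ?I (\<lambda>y. m / (y1 - y0)) = m"
    using y by (simp add: sp measure_restrict_space)
  ultimately have "m < integral\<^sup>L ?I \<nu>bar" by simp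
  moreover have "0 \<le> m" using h(2) by (simp add: m_def)
  ultimately have "ennreal m < ennreal (integral\<^sup>L ?I \<nu>bar)" by (simp add: ennreal_less_iff)
  moreover have "ennreal m = (\<integral>\<^sup>+x\<in>S. ennreal (h x) \<partial>lborel)"
    unfolding m_def using h(2) S(1)
    by (subst nn_integral_eq_integral[OF h_int, symmetric]) (auto simp: nn_integral_restrict_space)
  moreover have "ennreal (integral\<^sup>L ?I \<nu>bar) = (\<integral>\<^sup>+y\<in>{y0<..<y1}. ennreal (\<nu>bar y) \<partial>lborel)"
    using \<nu>(2)
    by (subst nn_integral_eq_integral[OF \<nu>_int, symmetric]) (auto simp: nn_integral_restrict_space)
  ultimately show ?thesis by simp
qed

theorem theorem22:
  fixes X :: "(real ^ 'm) set" and Y :: "real set"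
    and c :: "(real ^ 'm) \<times> real \<Rightarrow> real"
    and \<mu> :: "(real ^ 'm) measure" and \<nu> :: "real measure" and \<nu>bar :: "real \<Rightarrow> real"
    and g :: "real \<Rightarrow> real" and k :: "real \<Rightarrow> real" and M\<^sub>c :: real
  assumes "CARD('m) > 1"
    and "open X" "bounded X" "0 \<in> closure X"
    and "open Y" "bounded Y"
    and "C2_closure (X \<times> Y) c"
    and "twisted X Y c"
    and "nondegenerate X Y c"
    and "\<nu> \<in> prob_measures_on Y"
    and "\<nu>bar \<in> borel_measurable borel" "\<And>y. 0 \<le> \<nu>bar y"
    and "\<nu> = density lborel (\<lambda>y. ennreal (\<nu>bar y))"
    and "\<And>s. s > 0 \<Longrightarrow> g field_differentiable (at s)"
    and "continuous_on {0<..} (deriv g)"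
    and "strictly_convex_on {0..} g"
    and "filterlim (\<lambda>s. g s / s) at_top at_top"
    and "filterlim (deriv g) at_bot (at_right 0)"
    and "\<And>y. y \<in> closure Y \<Longrightarrow> M\<^sub>c-lipschitz_on (closure X) (\<lambda>x. c (x, y))"
    and "is_minimizer_on (prob_measures_on (closure X)) (total_cost X Y c g \<nu>) \<mu>"
    and "mass_splitting_level X Y c \<mu> \<nu> k"
    and "\<And>y0 y y1 x. \<lbrakk>y0 \<in> Y; y1 \<in> Y; y0 < y; y < y1;
           x \<in> X_ge X c y1 (k_max X c y0 y1 (k y0)) - X_ge X c y0 (ereal (k y0))\<rbrakk> \<Longrightarrow>
           ereal (deriv_inverse g (K X g (\<lambda>x'. M\<^sub>c * norm x') 1 + M\<^sub>c * norm x))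
             < (if D_vol_min X c y0 y1 (k y0) = 0 then \<infinity>
                else ereal (\<nu>bar y * (y1 - y0) / D_vol_min X c y0 y1 (k y0)))"
  shows "nested X Y c \<nu> k"
proof -
  interpret congestion_function g
    by unfold_locales (fact assms)+
  define h where "h x = deriv_inverse g (K X g (\<lambda>x'. M\<^sub>c * norm x') 1 + M\<^sub>c * norm x)" for x :: "real ^ 'm"
  define u where "u = density_of \<mu>"
  have hm [measurable]: "h \<in> borel_measurable borel" unfolding h_def by measurable
  have [measurable]: "u \<in> borel_measurable borel" by (simp add: u_def)
  have h0: "0 \<le> h x" for x by (simp add: h_def deriv_inverse_pos less_imp_le)
  have \<mu>P: "\<mu> \<in> prob_measures_on (closure X)" using assms(20) by (simp add: is_minimizer_on_def)
  then interpret \<mu>: prob_space \<mu> by (simp add: prob_measures_on_def)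
  have [measurable_cong]: "sets \<mu> = sets borel" using \<mu>P by (simp add: prob_measures_on_def)
  interpret \<nu>: prob_space \<nu> using assms(10) by (simp add: prob_measures_on_def)
  have [measurable_cong]: "sets \<nu> = sets borel" using assms(10) by (simp add: prob_measures_on_def)
  have "emeasure \<nu> Y \<le> emeasure \<nu> (closure Y)"
    by (rule emeasure_mono) (auto simp: closure_subset)
  then have \<nu>P: "\<nu> \<in> prob_measures_on (closure Y)"
    using assms(10) \<nu>.emeasure_le_1[of "closure Y"] by (simp add: prob_measures_on_def)
  have "X \<noteq> {}" using assms(4) by auto
  have "Y \<noteq> {}" using assms(10) by (auto simp: prob_measures_on_def)
  then have "M\<^sub>c \<ge> 0" using assms(19) lipschitz_on_nonneg closure_subset by blast
  have c: "continuous_on (closure X \<times> closure Y) c"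
    using assms(7) by (auto simp: C2_closure_def C2_derivatives_def closure_Times)
  have bound: "AE x in lborel. x \<in> X \<longrightarrow> u x \<le> h x"
    using minimizer_density_bound[OF assms(2,3) \<open>X \<noteq> {}\<close> assms(6) \<open>M\<^sub>c \<ge> 0\<close> c assms(19) \<nu>P assms(20)]
    by (simp add: u_def h_def)
  have ac: "absolutely_continuous lborel \<mu>"
    using minimizer_congestion_finite[OF assms(2,3) \<open>X \<noteq> {}\<close> assms(20)] unfolding congestion_def by metis
  then have \<mu>u: "\<mu> = density lborel (\<lambda>x. ennreal (u x))"
    unfolding u_def using \<mu>P \<mu>.finite_measure_axioms by (intro density_density_of) (auto simp: prob_measures_on_def)
  have \<nu>_int: "integrable lborel \<nu>bar"
  proof -
    have "emeasure \<nu> UNIV = (\<integral>\<^sup>+y. ennreal (\<nu>bar y) \<partial>lborel)"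
      using assms(11) by (subst assms(13), subst emeasure_density) auto
    then have "(\<integral>\<^sup>+y. ennreal (\<nu>bar y) \<partial>lborel) < \<infinity>"
      using \<nu>.emeasure_finite[of UNIV] by (simp add: less_top)
    then show ?thesis using assms(11,12) by (simp add: integrable_iff_bounded)
  qed

  have "X_ge X c y0 (ereal (k y0)) \<subseteq> X_gt X c y1 (ereal (k y1))"
    if y: "y0 \<in> Y" "y1 \<in> Y" "y0 < y1" and pos: "emeasure \<nu> {y0..y1} > 0" for y0 y1
  proof (rule ccontr)
    define A where "A = X_ge X c y0 (ereal (k y0))"
    define km where "km = k_max X c y0 y1 (k y0)"
    define B where "B = X_ge X c y1 km"
    define S where "S = B - A"
    assume "\<not> A \<subseteq> X_gt X c y1 (ereal (k y1))"
    have [measurable]: "A \<in> sets borel" "B \<in> sets borel"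
      unfolding A_def B_def by (rule X_ge_borel[OF assms(2,7)]; fact)+
    then have [measurable]: "S \<in> sets borel" by (simp add: S_def)
    have "A \<subseteq> B" unfolding A_def B_def km_def by (rule X_ge_subset_k_max)
    have "S \<subseteq> X" by (auto simp: S_def B_def X_ge_def)
    then have bS: "bounded S" using assms(3) bounded_subset by blast
    have D: "D_vol_min X c y0 y1 (k y0) = measure lborel S"
      by (simp add: D_vol_min_def S_def A_def B_def km_def)
    have S_less: "emeasure \<mu> S < emeasure \<nu> {y0..y1}"
    \<comment> \<open>For a null set \<open>S\<close> the assumed inequality has right-hand side
      \<open>\<infinity>\<close> and carries no information; strictness then comes from absolute
      continuity of \<open>\<mu>\<close> and positivity of \<open>\<nu>\<close> on the
      interval.\<close>
    proof (cases "measure lborel S = 0")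
      case True
      then have "S \<in> null_sets lborel"
        using emeasure_bounded_finite[OF bS] by (auto intro!: null_setsI simp: emeasure_eq_ennreal_measure)
      then have "emeasure \<mu> S = 0" using ac by (auto simp: absolutely_continuous_def)
      with pos show ?thesis by simp
    next
      case False
      have "emeasure \<mu> S = (\<integral>\<^sup>+x\<in>S. ennreal (u x) \<partial>lborel)"
        by (subst \<mu>u, subst emeasure_density) auto
      also have "\<dots> \<le> (\<integral>\<^sup>+x\<in>S. ennreal (h x) \<partial>lborel)"
        using bound \<open>S \<subseteq> X\<close>
        by (intro nn_integral_mono_AE) (auto elim!: eventually_mono simp: indicator_def intro!: ennreal_leI)
      also have "\<dots> < (\<integral>\<^sup>+y\<in>{y0<..<y1}. ennreal (\<nu>bar y) \<partial>lborel)"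
      proof (rule mass_less_of_density_bound[OF _ bS False y(3) hm h0 \<nu>_int assms(12)])
        fix x y assume "x \<in> S" "y0 < y" "y < y1"
        then show "h x < \<nu>bar y * (y1 - y0) / measure lborel S"
          using assms(22)[OF y(1,2), of y x] False unfolding D by (simp add: S_def A_def B_def km_def h_def)
      qed simp
      also have "\<dots> = emeasure \<nu> {y0<..<y1}"
        using assms(11) by (subst assms(13), subst emeasure_density) auto
      also have "\<dots> \<le> emeasure \<nu> {y0..y1}" by (rule emeasure_mono) auto
      finally show ?thesis .
    qed
    \<comment> \<open>A point violating nestedness squeezes the levels:
      \<open>km \<le> D_y c x y1 \<le> k y1\<close>. The super-level set of \<open>y1\<close> is
      then contained in \<open>B\<close>, whose mass is too small for it.\<close>
    obtain x where "x \<in> A" "x \<notin> X_gt X c y1 (ereal (k y1))"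
      using \<open>\<not> A \<subseteq> _\<close> by blast
    then have "ereal (D_y c x y1) \<le> ereal (k y1)"
      by (auto simp: A_def X_gt_def X_ge_def X_eq_def)
    moreover have "km \<le> ereal (D_y c x y1)"
      using \<open>x \<in> A\<close> \<open>A \<subseteq> B\<close> by (auto simp: B_def X_ge_def)
    ultimately have "km \<le> ereal (k y1)" by (rule order_trans[rotated])
    then have "X_ge X c y1 (ereal (k y1)) \<subseteq> B"
      by (auto simp: B_def X_ge_def intro: order_trans)
    then have "emeasure \<nu> {..y1} \<le> emeasure \<mu> B"
      using assms(21) y(2) emeasure_mono[of "X_ge X c y1 (ereal (k y1))" B \<mu>]
      by (simp add: mass_splitting_level_def)
    also have "\<dots> = emeasure \<mu> A + emeasure \<mu> S"
      using \<open>A \<subseteq> B\<close> by (subst plus_emeasure) (auto simp: S_def intro!: arg_cong[where f = "emeasure \<mu>"])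
    \<comment> \<open>Strictness survives the addition because \<open>emeasure \<mu> A\<close> is
      finite.\<close>
    also have "\<dots> < emeasure \<mu> A + emeasure \<nu> {y0..y1}"
      using S_less by (simp add: ennreal_add_left_cancel_less)
    also have "emeasure \<mu> A = emeasure \<nu> {..y0}"
      using assms(21) y(1) by (simp add: mass_splitting_level_def A_def)
    also have "\<dots> = emeasure \<nu> {..<y0}"
    proof -
      have "emeasure \<nu> {y0} = 0"
        using assms(11) by (subst assms(13), subst emeasure_density) (auto simp: nn_integral_indicator_singleton)
      then have "emeasure \<nu> ({..<y0} \<union> {y0}) = emeasure \<nu> {..<y0}"
        by (intro emeasure_Un_null_set) auto
      moreover have "{..<y0} \<union> {y0} = {..y0}" by auto
      ultimately show ?thesis by simp
    qed
    also have "\<dots> + emeasure \<nu> {y0..y1} = emeasure \<nu> {..y1}"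
      using y(3) by (subst plus_emeasure) (auto intro!: arg_cong[where f = "emeasure \<nu>"])
    finally show False by simp
  qed
  then show ?thesis unfolding nested_def by blast
qed

end
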